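(* Let $k\ge 3$ be an integer. There is a constant $C_k$ depending only on $k$ such that for every integer $n>1$ with $\gcd(n,(k-1)!)=1$ and every $g\in C^3(\mathbb{R}^{k-1})$, \[|\mathbb{E}\,g(W)-\mathbb{E}\,g(Z)|\le C_k\,\frac{M_2(g)+M_3(g)}{n^{1/2}},\] where $W=(F_1(y),F_3(y),F_4(y),\ldots,F_k(y))\in\mathbb{R}^{k-1}$ (the index $2$ is omitted), $y=(y_i)_{i\in\mathbb{Z}/n\mathbb{Z}}$ is a vector of independent standard normal random variables, and $Z$ is a standard Gaussian random vector in $\mathbb{R}^{k-1}$.
   Context: For $1\le\ell\le k$ define the polynomial in variables $(y_i)_{i\in\mathbb{Z}/n\mathbb{Z}}$ \[F_\ell(y)=\frac{1}{\sigma_\ell}\sum_{a\in\mathbb{Z}/n\mathbb{Z}}\ \sum_{d=1}^{\lfloor n/2\rfloor}\ \sum_{\substack{S\subseteq\{0,1,\ldots,k-1\}\\|S|=\ell}}\ \prod_{i\in S}y_{a+id},\] indices modulo $n$, where $\sigma_\ell>0$ is the normalizing constant for which $\operatorname{Var}[F_\ell(z)]=1$ when $z$ is a vector of independent standard normals. (In the paper $F_\ell$ is denoted $\overline{\mathbf{kAP}}^{\ell}$.) For $g\in C^r(\mathbb{R}^m)$, $M_r(g)=\sup_{x\in\mathbb{R}^m}\|D^rg(x)\|_{\mathrm{op}}$, where $D^rg(x)$ is the $r$-linear form $(u_1,\ldots,u_r)\mapsto\sum_{i_1,\ldots,i_r}\frac{\partial^rg}{\partial x_{i_1}\cdots\partial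 x_{i_r}}(x)(u_1)_{i_1}\cdots(u_r)_{i_r}$ and the operator norm of an $r$-linear form $A$ is $\|A\|_{\mathrm{op}}=\sup_{|v_1|=\cdots=|v_r|=1}|A(v_1,\ldots,v_r)|$ (Euclidean norms). If $M_2(g)$ or $M_3(g)$ is infinite the inequality is regarded as vacuous. *)

theory Defs
  imports "HOL-Probability.Probability"
begin

definition std_gaussian :: "'i set \<Rightarrow> ('i \<Rightarrow> real) measure" where
  "std_gaussian I = Pi\<^sub>M I (\<lambda>_. density lborel std_normal_density)"

text \<open>The residues modulo \<open>n\<close> are represented by \<open>0, \<dots>, n - 1\<close>.\<close>

definition kAP :: "nat \<Rightarrow> nat \<Rightarrow> nat \<Rightarrow> (nat \<Rightarrow> real) \<Rightarrow> real" where
  "kAP k n l y =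
     (\<Sum>a<n. \<Sum>d = 1..n div 2. \<Sum>S | S \<subseteq> {0..<k} \<and> card S = l.
        \<Prod>i\<in>S. y ((a + i * d) mod n))"

definition kAP_sigma :: "nat \<Rightarrow> nat \<Rightarrow> nat \<Rightarrow> real" where
  "kAP_sigma k n l =
     (THE s. s > 0 \<and> prob_space.variance (std_gaussian {..<n}) (\<lambda>z. 1 / s * kAP k n l z) = 1)"

definition kAP_bar :: "nat \<Rightarrow> nat \<Rightarrow> nat \<Rightarrow> (nat \<Rightarrow> real) \<Rightarrow> real" where
  "kAP_bar k n l y = 1 / kAP_sigma k n l * kAP k n l y"

definition partial :: "'m::finite \<Rightarrow> (real^'m \<Rightarrow> real) \<Rightarrow> real^'m \<Rightarrow> real" where
  "partial i g x = deriv (\<lambda>t. g (x + t *\<^sub>R axis i 1)) 0"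

text \<open>\<open>partials [i\<^sub>1, \<dots>, i\<^sub>r] g\<close> is \<open>\<partial>\<^sup>rg / \<partial>x\<^bsub>i\<^sub>1\<^esub> \<dots> \<partial>x\<^bsub>i\<^sub>r\<^esub>\<close>, the last index
  being differentiated first.\<close>

definition partials :: "'m::finite list \<Rightarrow> (real^'m \<Rightarrow> real) \<Rightarrow> real^'m \<Rightarrow> real" where
  "partials is g = foldr partial is g"

definition C_class :: "nat \<Rightarrow> (real^'m::finite \<Rightarrow> real) \<Rightarrow> bool" where
  "C_class r g \<longleftrightarrow>
     (\<forall>is. length is \<le> r \<longrightarrow> continuous_on UNIV (partials is g)) \<and>
     (\<forall>is i x. length is < r \<longrightarrow>
        (\<lambda>t. partials is g (x + t *\<^sub>R axis i 1)) differentiable at 0)"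

text \<open>\<open>r\<close>-linear forms take the list of their \<open>r\<close> arguments.\<close>

definition D_form :: "nat \<Rightarrow> (real^'m::finite \<Rightarrow> real) \<Rightarrow> real^'m \<Rightarrow> (real^'m) list \<Rightarrow> real" where
  "D_form r g x us = (\<Sum>is | length is = r. partials is g x * (\<Prod>j<r. us ! j $ is ! j))"

definition form_op_norm :: "nat \<Rightarrow> ((real^'m::finite) list \<Rightarrow> real) \<Rightarrow> ereal" where
  "form_op_norm r A = (SUP vs \<in> {vs. length vs = r \<and> (\<forall>v\<in>set vs. norm v = 1)}. ereal \<bar>A vs\<bar>)"

definition M_sup :: "nat \<Rightarrow> (real^'m::finite \<Rightarrow> real) \<Rightarrow> ereal" where
  "M_sup r g = (SUP x. form_op_norm r (D_form r g x))"

end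

theory Submission
  imports Defs "HOL-Real_Asymp.Real_Asymp"
begin

text \<open>
  Put \<open>U \<theta> = sin \<theta> W + cos \<theta> Z\<close> and \<open>\<phi> \<theta> = E g(U \<theta>)\<close>, so that \<open>E g(W) - E g(Z) = \<phi>(\<pi>/2) - \<phi>(0)\<close>.
  The coordinates of \<open>W\<close> are multilinear, and homogeneous of degree \<open>l\<^sub>i\<close>; by Euler's identity and Gaussian
  integration by parts,
  \<open>\<phi>' = sin \<theta> cos \<theta> \<Sum>\<^sub>i\<^sub>j E[(\<Sum>\<^sub>a \<partial>\<^sub>aW\<^sub>i \<partial>\<^sub>aW\<^sub>j / l\<^sub>i - \<delta>\<^sub>i\<^sub>j) \<partial>\<^sub>j\<partial>\<^sub>ig(U \<theta>)]\<close>.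
  Multilinearity makes \<open>\<partial>\<^sub>aW\<^sub>i\<close> independent of \<open>y\<^sub>a\<close>, so no further derivative of \<open>W\<close> appears.
  It remains to bound the variance of \<open>\<Sum>\<^sub>a \<partial>\<^sub>aW\<^sub>i \<partial>\<^sub>aW\<^sub>j\<close> by \<open>O(1/n)\<close>. For degrees at least \<open>3\<close> it is
  \<open>O(n\<^sup>-\<^sup>2)\<close> times a sum of about \<open>n\<^sup>3\<close> monomials, one for each pair of progressions with a common term \<open>a\<close>.
  Two residues lie in boundedly many progressions, and a monomial has mean zero as soon as some variable
  occurs in it exactly once; hence only \<open>O(n\<^sup>3)\<close> pairs of monomials are correlated.
\<close>

section \<open>Moments of the standard Gaussian measure\<close>

text \<open>Two residues fix a progression up to boundedly many choices, and differentiation removes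
  one variable from a monomial; so the counting wants at least three variables per monomial, in
  order to leave two. This singles out two degrees. Degree 2 is absent from the statement because
  differences of positions are units modulo \<open>n\<close> and \<open>n\<close> is odd: its
  monomials run over all pairs of distinct residues equally often, and the sum is a multiple of (sum
  y)^2 - sum y^2, which is not asymptotically normal. Degree 1 is harmless, because its gradient is
  the constant n^(-1/2); its product with another gradient is linear in the latter, and a separate
  count of order n^2 suffices.

  The squared coefficients are O(n^-2) since there are about n^2 progressions and coincidences among
  them only raise the variance. The rate n^(-1/2) is the square root of the variance bound, lost in
  passing to first absolute moments. \<open>Z\<close> is realised by fresh coordinates beside those
  of \<open>y\<close>, so that one integration by parts formula serves both.\<close>

lemma prob_space_std_normal_distribution: "prob_space std_normal_distribution"
  by (rule prob_space_normal_density) simp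

lemma product_prob_space_std_normal_distribution: "product_prob_space (\<lambda>_. std_normal_distribution)"
  by (rule product_prob_spaceI) (rule prob_space_std_normal_distribution)

lemma prob_space_std_gaussian: "prob_space (std_gaussian I)"
  unfolding std_gaussian_def by (intro prob_space_PiM prob_space_std_normal_distribution)

lemma measurable_std_normal_distribution:
  "measurable M std_normal_distribution = borel_measurable M"
  "measurable std_normal_distribution N = measurable borel N"
  by (rule measurable_cong_sets; simp)+

lemma measurable_coord:
  "a \<in> I \<Longrightarrow> (\<lambda>x. x a) \<in> borel_measurable (std_gaussian I)"
  using measurable_component_singleton[of a I "\<lambda>_. std_normal_distribution"]
  unfolding std_gaussian_def by simp

lemma integrable_std_normal_power: "integrable std_normal_distribution (\<lambda>x. x ^ p)"
  by (subst integrable_density) (simp_all add: integrable_std_normal_moment)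

lemma integrable_std_normal_power_abs: "integrable std_normal_distribution (\<lambda>x. \<bar>x\<bar> ^ p)"
  by (subst integrable_density) (simp_all add: integrable_std_normal_moment_abs)

definition std_normal_moment :: "nat \<Rightarrow> real" where "std_normal_moment p = (\<integral>x. x ^ p \<partial>std_normal_distribution)"

lemma std_normal_moment_even_eq: "std_normal_moment (2 * p) = fact (2 * p) / (2 ^ p * fact p)"
  unfolding std_normal_moment_def by (subst integral_density) (simp_all add: integral_std_normal_moment_even)

lemma std_normal_moment_odd_eq:
  assumes "odd p"
  shows "std_normal_moment p = 0"
proof -
  obtain q where "p = 2 * q + 1" using assms by (elim oddE)
  then show ?thesis unfolding std_normal_moment_def
    using integral_std_normal_moment_odd[of q] by (subst integral_density) simp_all
qed

lemma std_normal_moment_0: "std_normal_moment 0 = 1" using std_normal_moment_even_eq[of 0] by simp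
lemma std_normal_moment_2: "std_normal_moment 2 = 1" using std_normal_moment_even_eq[of 1] by (simp add: fact_numeral)
lemma std_normal_moment_4: "std_normal_moment 4 = 3" using std_normal_moment_even_eq[of 2] by (simp add: fact_numeral)

lemma integrable_std_gaussian_coord:
  assumes "a \<in> I" and "(f :: real \<Rightarrow> real) \<in> borel_measurable borel"
  shows "integrable (std_gaussian I) (\<lambda>x. f (x a)) \<longleftrightarrow> integrable std_normal_distribution f"
proof -
  have *: "distr (std_gaussian I) std_normal_distribution (\<lambda>x. x a) = std_normal_distribution"
    unfolding std_gaussian_def
    by (rule distr_PiM_component[OF prob_space_std_normal_distribution assms(1)])
  have m: "(\<lambda>x. x a) \<in> measurable (std_gaussian I) std_normal_distribution"
    unfolding measurable_std_normal_distribution by (rule measurable_coord[OF assms(1)])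
  have f: "f \<in> borel_measurable std_normal_distribution"
    unfolding measurable_std_normal_distribution by (fact assms(2))
  show "integrable (std_gaussian I) (\<lambda>x. f (x a)) \<longleftrightarrow> integrable std_normal_distribution f"
    using integrable_distr_eq[OF m f] unfolding * by (rule sym)
qed

text \<open>Moves both expectations of the theorem to one index set: \<open>f\<close> is the
  inclusion for \<open>W\<close>, and \<open>\<zeta>\<close> for \<open>Z\<close>.\<close>

lemma integral_std_gaussian_reindex:
  fixes h :: "('j \<Rightarrow> real) \<Rightarrow> real"
  assumes f: "inj_on f J" "f \<in> J \<rightarrow> I" and h: "h \<in> borel_measurable (std_gaussian J)"
  shows "(\<integral>x. h x \<partial>std_gaussian J) = (\<integral>x. h (\<lambda>j\<in>J. x (f j)) \<partial>std_gaussian I)"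
proof -
  have m: "(\<lambda>x. \<lambda>j\<in>J. x (f j)) \<in> measurable (std_gaussian I) (std_gaussian J)"
    unfolding std_gaussian_def using f(2) by (intro measurable_restrict measurable_component_singleton) auto
  have "distr (std_gaussian I) (std_gaussian J) (\<lambda>x. \<lambda>j\<in>J. x (f j)) = std_gaussian J"
    unfolding std_gaussian_def by (rule distr_PiM_reindex[OF prob_space_std_normal_distribution f])
  then show ?thesis using integral_distr[OF m h] by simp
qed

lemma integral_std_gaussian_prod_power:
  assumes "finite I"
  shows "(\<integral>x. (\<Prod>v\<in>I. x v ^ e v) \<partial>std_gaussian I) = (\<Prod>v\<in>I. std_normal_moment (e v))"
proof -
  interpret product_prob_space "\<lambda>_::'a. std_normal_distribution" by (rule product_prob_space_std_normal_distribution)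
  show ?thesis unfolding std_gaussian_def std_normal_moment_def
    by (rule product_integral_prod) (auto simp: assms integrable_std_normal_power)
qed

section \<open>Functions with all absolute moments\<close>

text \<open>Products of integrable functions need not be integrable, whereas this class is closed
  under sums and products, so integrability of polynomial expressions reduces to closure
  rules.\<close>

definition all_moments :: "'a measure \<Rightarrow> ('a \<Rightarrow> real) \<Rightarrow> bool" where
  "all_moments M f \<longleftrightarrow> f \<in> borel_measurable M \<and> (\<forall>p. integrable M (\<lambda>x. \<bar>f x\<bar> ^ p))"

lemma all_moments_measurable: "all_moments M f \<Longrightarrow> f \<in> borel_measurable M"
  by (simp add: all_moments_def)

lemma all_moments_bound:
  assumes "all_moments M h" "f \<in> borel_measurable M" "\<And>x. x \<in> space M \<Longrightarrow> \<bar>f x\<bar> \<le> h x"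
  shows "all_moments M f"
  unfolding all_moments_def
proof safe
  fix p
  show "integrable M (\<lambda>x. \<bar>f x\<bar> ^ p)"
  proof (rule Bochner_Integration.integrable_bound)
    show "integrable M (\<lambda>x. \<bar>h x\<bar> ^ p)" using assms(1) by (simp add: all_moments_def)
    show "AE x in M. norm (\<bar>f x\<bar> ^ p) \<le> norm (\<bar>h x\<bar> ^ p)"
      using assms(3) by (intro AE_I2) (force intro!: power_mono simp: power_abs)
  qed (use assms(2) in measurable)
qed (fact assms(2))

lemma all_moments_integrable: "all_moments M f \<Longrightarrow> integrable M f"
proof -
  assume f: "all_moments M f"
  then have "integrable M (\<lambda>x. \<bar>f x\<bar> ^ 1)" unfolding all_moments_def by blast
  then have "integrable M (\<lambda>x. \<bar>f x\<bar>)" by (simp only: power_one_right)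
  then show "integrable M f" by (rule integrable_abs_cancel[OF _ all_moments_measurable[OF f]])
qed

lemma all_moments_const: "prob_space M \<Longrightarrow> all_moments M (\<lambda>_. c)"
  unfolding all_moments_def by (simp add: prob_space.finite_measure finite_measure.integrable_const)

lemma all_moments_add:
  assumes "all_moments M f" "all_moments M g" shows "all_moments M (\<lambda>x. f x + g x)"
  unfolding all_moments_def
proof safe
  have [measurable]: "f \<in> borel_measurable M" "g \<in> borel_measurable M"
    using assms by (auto simp: all_moments_def)
  show "(\<lambda>x. f x + g x) \<in> borel_measurable M" by measurable
  fix p
  have "\<bar>a + b\<bar> ^ p \<le> 2 ^ p * (\<bar>a\<bar> ^ p + \<bar>b\<bar> ^ p)" for a b :: real
  proof -
    have "\<bar>a + b\<bar> ^ p \<le> (2 * max \<bar>a\<bar> \<bar>b\<bar>) ^ p" by (intro power_mono) auto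
    also have "\<dots> = 2 ^ p * max \<bar>a\<bar> \<bar>b\<bar> ^ p" by (simp add: power_mult_distrib)
    also have "\<dots> \<le> 2 ^ p * (\<bar>a\<bar> ^ p + \<bar>b\<bar> ^ p)" by (intro mult_left_mono) (auto simp: max_def)
    finally show ?thesis .
  qed
  moreover have "integrable M (\<lambda>x. 2 ^ p * (\<bar>f x\<bar> ^ p + \<bar>g x\<bar> ^ p))"
    using assms by (auto simp: all_moments_def)
  ultimately show "integrable M (\<lambda>x. \<bar>f x + g x\<bar> ^ p)"
    by (intro Bochner_Integration.integrable_bound[OF \<open>integrable M (\<lambda>x. 2 ^ p * (\<bar>f x\<bar> ^ p + \<bar>g x\<bar> ^ p))\<close>] AE_I2)
      simp_all
qed

lemma all_moments_mult:
  assumes "all_moments M f" "all_moments M g" shows "all_moments M (\<lambda>x. f x * g x)"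
  unfolding all_moments_def
proof safe
  have [measurable]: "f \<in> borel_measurable M" "g \<in> borel_measurable M"
    using assms by (auto simp: all_moments_def)
  show "(\<lambda>x. f x * g x) \<in> borel_measurable M" by measurable
  fix p
  have "\<bar>a * b\<bar> ^ p \<le> \<bar>a\<bar> ^ (2 * p) + \<bar>b\<bar> ^ (2 * p)" for a b :: real
  proof -
    have "0 \<le> (\<bar>a\<bar> ^ p - \<bar>b\<bar> ^ p)\<^sup>2 + (\<bar>a\<bar> ^ p)\<^sup>2 + (\<bar>b\<bar> ^ p)\<^sup>2" by simp
    then show ?thesis
      by (simp add: power2_diff abs_mult power_mult_distrib mult.commute[of 2] power_mult)
  qed
  moreover have "integrable M (\<lambda>x. \<bar>f x\<bar> ^ (2 * p) + \<bar>g x\<bar> ^ (2 * p))"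
    using assms by (auto simp: all_moments_def)
  ultimately show "integrable M (\<lambda>x. \<bar>f x * g x\<bar> ^ p)"
    by (intro Bochner_Integration.integrable_bound[OF \<open>integrable M (\<lambda>x. \<bar>f x\<bar> ^ (2 * p) + \<bar>g x\<bar> ^ (2 * p))\<close>] AE_I2)
      simp_all
qed

lemma all_moments_sum:
  "prob_space M \<Longrightarrow> (\<And>i. i \<in> A \<Longrightarrow> all_moments M (f i)) \<Longrightarrow> all_moments M (\<lambda>x. \<Sum>i\<in>A. f i x)"
  by (induction A rule: infinite_finite_induct) (auto intro: all_moments_add all_moments_const)

lemma all_moments_prod:
  "prob_space M \<Longrightarrow> (\<And>i. i \<in> A \<Longrightarrow> all_moments M (f i)) \<Longrightarrow> all_moments M (\<lambda>x. \<Prod>i\<in>A. f i x)"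
  by (induction A rule: infinite_finite_induct) (auto intro: all_moments_mult all_moments_const)

lemma all_moments_abs: "all_moments M f \<Longrightarrow> all_moments M (\<lambda>x. \<bar>f x\<bar>)"
  by (auto simp: all_moments_def)

lemma all_moments_coord: "a \<in> I \<Longrightarrow> all_moments (std_gaussian I) (\<lambda>x. x a)"
  unfolding all_moments_def
  by (auto intro!: measurable_coord simp: integrable_std_gaussian_coord[of a I "\<lambda>t. \<bar>t\<bar> ^ _"] integrable_std_normal_power_abs)

section \<open>Gaussian integration by parts\<close>

text \<open>Since the density satisfies \<phi>' = -t \<phi>, the function -h \<phi> is a primitive
  of \<phi> (t h - h'). A bounded h' makes h grow at most linearly, so the boundary terms
  vanish.\<close>

lemma std_normal_by_parts:
  fixes h h' :: "real \<Rightarrow> real"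
  assumes h: "\<And>t. (h has_real_derivative h' t) (at t)" and cont: "continuous_on UNIV h'"
    and bd: "\<And>t. \<bar>h' t\<bar> \<le> B"
  shows "(\<integral>t. t * h t \<partial>std_normal_distribution) = (\<integral>t. h' t \<partial>std_normal_distribution)"
proof -
  let ?\<phi> = std_normal_density
  have conth: "continuous_on UNIV h"
    using h DERIV_isCont continuous_at_imp_continuous_on by blast
  have [measurable]: "h \<in> borel_measurable borel" "h' \<in> borel_measurable borel"
    using conth cont by (auto intro: borel_measurable_continuous_onI)
  have B0: "0 \<le> B" using bd[of 0] by linarith
  have lin: "\<bar>h t\<bar> \<le> \<bar>h 0\<bar> + B * \<bar>t\<bar>" for t
  proof -
    have "norm (h t - h 0) \<le> B * norm (t - 0)"
      by (rule field_differentiable_bound[OF convex_UNIV]) (auto intro: h simp: bd)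
    then show ?thesis by simp
  qed
  have i1: "integrable std_normal_distribution h'"
  proof (rule Bochner_Integration.integrable_bound)
    show "integrable std_normal_distribution (\<lambda>t. B * t ^ 0)" using integrable_std_normal_power[of 0] by (intro integrable_mult_right) auto
  qed (use bd B0 in auto)
  have i2: "integrable std_normal_distribution (\<lambda>t. t * h t)"
  proof (rule Bochner_Integration.integrable_bound)
    show "integrable std_normal_distribution (\<lambda>t. \<bar>h 0\<bar> * \<bar>t\<bar> ^ 1 + B * \<bar>t\<bar> ^ 2)"
      by (intro Bochner_Integration.integrable_add integrable_mult_right integrable_std_normal_power_abs)
    have "\<bar>t * h t\<bar> \<le> \<bar>h 0\<bar> * \<bar>t\<bar> ^ 1 + B * \<bar>t\<bar> ^ 2" for t
    proof -
      have "\<bar>t * h t\<bar> = \<bar>t\<bar> * \<bar>h t\<bar>" by (simp add: abs_mult)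
      also have "\<dots> \<le> \<bar>t\<bar> * (\<bar>h 0\<bar> + B * \<bar>t\<bar>)" by (intro mult_left_mono lin) auto
      finally show ?thesis by (simp add: algebra_simps power2_eq_square)
    qed
    then show "AE t in std_normal_distribution. norm (t * h t) \<le> norm (\<bar>h 0\<bar> * \<bar>t\<bar> ^ 1 + B * \<bar>t\<bar> ^ 2)"
      by (intro AE_I2) (metis abs_ge_self order_trans real_norm_def)
  qed auto
  let ?F = "\<lambda>t. - h t * ?\<phi> t" and ?f = "\<lambda>t. ?\<phi> t * (t * h t) - ?\<phi> t * h' t"
  have int: "integrable lborel ?f"
    using i1 i2 by (intro Bochner_Integration.integrable_diff) (auto simp: integrable_density)
  have d\<phi>: "(?\<phi> has_real_derivative (- t * ?\<phi> t)) (at t)" for t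
    unfolding std_normal_density_def by (auto intro!: derivative_eq_intros simp: field_simps)
  have cphi: "isCont ?\<phi> t" for t using d\<phi> DERIV_isCont by blast
  have "(LBINT t=-\<infinity>..\<infinity>. ?f t) = 0 - 0"
  proof (rule interval_integral_FTC_integrable)
    show "(?F has_vector_derivative ?f t) (at t)" for t
      unfolding has_real_derivative_iff_has_vector_derivative[symmetric]
      by (auto intro!: derivative_eq_intros h d\<phi> simp: algebra_simps)
    show "isCont ?f t" for t
      using conth cont cphi by (intro continuous_intros) (auto simp: continuous_on_eq_continuous_at)
    show "set_integrable lborel (einterval (- \<infinity>) \<infinity>) ?f"
      using int by (simp add: set_integrable_def)
    have lim: "(?F \<longlongrightarrow> 0) F" if "((\<lambda>t. (\<bar>h 0\<bar> + B * \<bar>t\<bar>) * ?\<phi> t) \<longlongrightarrow> 0) F" for F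
      by (rule Lim_null_comparison[OF _ that]) (auto intro!: mult_right_mono lin always_eventually simp: abs_mult)
    have "((\<lambda>t. (\<bar>h 0\<bar> + B * \<bar>t\<bar>) * ?\<phi> t) \<longlongrightarrow> 0) at_top"
      unfolding std_normal_density_def by real_asymp
    from lim[OF this] show "((?F \<circ> real_of_ereal) \<longlongrightarrow> 0) (at_left \<infinity>)"
      by (simp add: at_left_PInf filterlim_filtermap o_def)
    have "((\<lambda>t. (\<bar>h 0\<bar> + B * \<bar>t\<bar>) * ?\<phi> t) \<longlongrightarrow> 0) at_bot"
      unfolding std_normal_density_def by real_asymp
    from lim[OF this] show "((?F \<circ> real_of_ereal) \<longlongrightarrow> 0) (at_right (-\<infinity>))"
      by (simp add: at_right_MInf filterlim_filtermap o_def)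
  qed auto
  then have "(\<integral>t. ?f t \<partial>lborel) = 0" by (simp add: interval_integral_to_infinity_eq interval_lebesgue_integral_def set_lebesgue_integral_def)
  then have "(\<integral>t. ?\<phi> t * (t * h t) \<partial>lborel) - (\<integral>t. ?\<phi> t * h' t \<partial>lborel) = 0"
    using i1 i2 by (subst Bochner_Integration.integral_diff[symmetric]) (auto simp: integrable_density)
  then show ?thesis by (subst (1 2) integral_density) simp_all
qed

text \<open>Fubini in the coordinate \<open>a\<close>. The bound \<open>B\<close> may depend on the
  other coordinates, because the derivatives to come have polynomial factors that are unbounded in
  them.\<close>

lemma std_gaussian_by_parts:
  fixes f f' :: "('i \<Rightarrow> real) \<Rightarrow> real"
  assumes I: "finite I" "a \<in> I"
    and deriv: "\<And>x t. ((\<lambda>t. f (x(a := t))) has_real_derivative f' (x(a := t))) (at t)"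
    and cont: "\<And>x. continuous_on UNIV (\<lambda>t. f' (x(a := t)))"
    and bd: "\<And>x. \<exists>B. \<forall>t. \<bar>f' (x(a := t))\<bar> \<le> B"
    and int: "integrable (std_gaussian I) (\<lambda>x. x a * f x)" "integrable (std_gaussian I) f'"
  shows "(\<integral>x. x a * f x \<partial>std_gaussian I) = (\<integral>x. f' x \<partial>std_gaussian I)"
proof -
  interpret product_prob_space "\<lambda>_::'i. std_normal_distribution" by (rule product_prob_space_std_normal_distribution)
  let ?J = "I - {a}"
  have ins: "insert a ?J = I" using I by auto
  have *: "(\<integral>x. u x \<partial>std_gaussian I) = (\<integral>x. (\<integral>t. u (x(a := t)) \<partial>std_normal_distribution) \<partial>Pi\<^sub>M ?J (\<lambda>_. std_normal_distribution))"
    if "integrable (std_gaussian I) u" for u :: "_ \<Rightarrow> real"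
    using product_integral_insert[of ?J a u] that I unfolding std_gaussian_def ins by blast
  have "(\<integral>t. (x(a := t)) a * f (x(a := t)) \<partial>std_normal_distribution) = (\<integral>t. f' (x(a := t)) \<partial>std_normal_distribution)" for x
  proof -
    obtain B where "\<forall>t. \<bar>f' (x(a := t))\<bar> \<le> B" using bd by blast
    with std_normal_by_parts[of "\<lambda>t. f (x(a := t))", OF deriv cont] have "(\<integral>t. t * f (x(a := t)) \<partial>std_normal_distribution) = (\<integral>t. f' (x(a := t)) \<partial>std_normal_distribution)"
      by blast
    then show ?thesis by (simp only: fun_upd_same)
  qed
  then show ?thesis unfolding *[OF int(1)] *[OF int(2)] by (simp only:)
qed

section \<open>Continuously differentiable functions\<close>

text \<open>\<open>C_class\<close> speaks of derivatives along the axes, while the chain rule along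
  \<open>\<theta>\<close> needs a total derivative. From \<open>x\<close> to \<open>x + v\<close>
  one moves along one axis at a time; on each leg the mean value inequality and continuity of that
  partial at \<open>x\<close> bound the error.\<close>

lemma has_derivative_if_continuous_partials:
  fixes G :: "real^'m::finite \<Rightarrow> real"
  assumes pd: "\<And>i x. ((\<lambda>t. G (x + t *\<^sub>R axis i 1)) has_real_derivative P i x) (at 0)"
    and cont: "\<And>i. continuous_on UNIV (P i)"
  shows "(G has_derivative (\<lambda>v. \<Sum>i\<in>UNIV. v $ i * P i x)) (at x)"
proof -
  have line: "((\<lambda>t. G (u + t *\<^sub>R axis i 1)) has_real_derivative P i (u + s *\<^sub>R axis i 1)) (at s)" for u i s
  proof -
    have "((\<lambda>t. G (u + (t + s) *\<^sub>R axis i 1)) has_real_derivative P i (u + s *\<^sub>R axis i 1)) (at 0)"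
      using pd[of "u + s *\<^sub>R axis i 1" i] by (simp add: algebra_simps)
    then show ?thesis
      using DERIV_shift[of "\<lambda>t. G (u + t *\<^sub>R axis i 1)" "P i (u + s *\<^sub>R axis i 1)" 0 s] by simp
  qed
  \<comment> \<open>Induction on the set of axes already used; measured in the 1-norm, the errors of
    the single legs just add up.\<close>
  have approx: "\<exists>d>0. \<forall>v. (\<Sum>i\<in>UNIV. \<bar>v $ i\<bar>) < d \<longrightarrow>
      \<bar>G (x + (\<Sum>i\<in>S. (v $ i) *\<^sub>R axis i 1)) - G x - (\<Sum>i\<in>S. v $ i * P i x)\<bar> \<le> e * (\<Sum>i\<in>S. \<bar>v $ i\<bar>)"
    if "e > 0" for e and S :: "'m set"
    using finite[of S]
  proof (induction S)
    case empty
    show ?case by (auto intro: exI[of _ 1])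
  next
    case (insert j S)
    then obtain d1 where d1: "d1 > 0" and IH: "\<And>v. (\<Sum>i\<in>UNIV. \<bar>v $ i\<bar>) < d1 \<Longrightarrow>
      \<bar>G (x + (\<Sum>i\<in>S. (v $ i) *\<^sub>R axis i 1)) - G x - (\<Sum>i\<in>S. v $ i * P i x)\<bar> \<le> e * (\<Sum>i\<in>S. \<bar>v $ i\<bar>)"
      by blast
    have "isCont (P j) x" using cont by (simp add: continuous_on_eq_continuous_at)
    then obtain d2 where d2: "d2 > 0" and P: "\<And>y. dist y x < d2 \<Longrightarrow> dist (P j y) (P j x) < e"
      using \<open>e > 0\<close> unfolding continuous_at_eps_delta by blast
    show ?case
    proof (intro exI[of _ "min d1 d2"] conjI allI impI)
      fix v :: "real^'m" assume v: "(\<Sum>i\<in>UNIV. \<bar>v $ i\<bar>) < min d1 d2"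
      define w where "w = (\<Sum>i\<in>S. (v $ i) *\<^sub>R axis i (1::real))"
      \<comment> \<open>Mean value inequality for \<open>G\<close> minus its linear part along axis
        \<open>j\<close>, whose slope stays within \<open>e\<close> near \<open>x\<close>.\<close>
      have "norm (G (x + w + (v $ j) *\<^sub>R axis j 1) - v $ j * P j x - (G (x + w + 0 *\<^sub>R axis j 1) - 0 * P j x))
          \<le> e * norm (v $ j - 0)"
      proof (rule field_differentiable_bound)
        show "convex (cball (0::real) \<bar>v $ j\<bar>)" by simp
        fix s assume s: "s \<in> cball (0::real) \<bar>v $ j\<bar>"
        show "((\<lambda>t. G (x + w + t *\<^sub>R axis j 1) - t * P j x) has_real_derivative
            P j (x + w + s *\<^sub>R axis j 1) - P j x) (at s within cball (0::real) \<bar>v $ j\<bar>)"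
          by (rule DERIV_subset[OF DERIV_diff[OF line] subset_UNIV])
            (use DERIV_cmult_right[OF DERIV_ident, of "P j x" s UNIV] in simp)
        have "norm (w + s *\<^sub>R axis j 1) \<le> (\<Sum>i\<in>S. \<bar>v $ i\<bar>) + \<bar>v $ j\<bar>"
        proof (rule norm_triangle_le, rule add_mono)
          have "norm w \<le> (\<Sum>i\<in>S. norm ((v $ i) *\<^sub>R axis i (1::real)))" unfolding w_def by (rule norm_sum)
          then show "norm w \<le> (\<Sum>i\<in>S. \<bar>v $ i\<bar>)" by (simp add: norm_axis_1)
          show "norm (s *\<^sub>R axis j (1::real)) \<le> \<bar>v $ j\<bar>" using s by (simp add: norm_axis_1)
        qed
        also have "\<dots> = (\<Sum>i\<in>insert j S. \<bar>v $ i\<bar>)" using insert.hyps by simp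
        also have "\<dots> \<le> (\<Sum>i\<in>UNIV. \<bar>v $ i\<bar>)" by (rule sum_mono2) auto
        finally have "dist (x + w + s *\<^sub>R axis j 1) x < d2"
          using v by (simp add: dist_norm add.assoc)
        from P[OF this] show "norm (P j (x + w + s *\<^sub>R axis j 1) - P j x) \<le> e"
          by (simp add: dist_norm)
      qed auto
      then have "\<bar>G (x + w + (v $ j) *\<^sub>R axis j 1) - G (x + w) - v $ j * P j x\<bar> \<le> e * \<bar>v $ j\<bar>"
        by (simp add: algebra_simps)
      moreover have "\<bar>G (x + w) - G x - (\<Sum>i\<in>S. v $ i * P i x)\<bar> \<le> e * (\<Sum>i\<in>S. \<bar>v $ i\<bar>)"
        using IH[of v] v unfolding w_def by simp
      ultimately show "\<bar>G (x + (\<Sum>i\<in>insert j S. (v $ i) *\<^sub>R axis i 1)) - G x - (\<Sum>i\<in>insert j S. v $ i * P i x)\<bar>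
          \<le> e * (\<Sum>i\<in>insert j S. \<bar>v $ i\<bar>)"
        using insert.hyps by (simp add: w_def[symmetric] algebra_simps)
    qed (use d1 d2 in auto)
  qed
  let ?N = "real CARD('m)"
  have N: "?N > 0" by simp
  have l1: "(\<Sum>i\<in>UNIV. \<bar>v $ i\<bar>) \<le> ?N * norm v" for v :: "real^'m"
    using sum_bounded_above[of UNIV "\<lambda>i. \<bar>v $ i\<bar>" "norm v"] component_le_norm_cart[of v] by auto
  show ?thesis
    unfolding has_derivative_at_alt
  proof (intro conjI allI impI)
    show "bounded_linear (\<lambda>v. \<Sum>i\<in>UNIV. v $ i * P i x)"
      by (intro bounded_linear_sum bounded_linear_mult_left[THEN bounded_linear_compose] bounded_linear_vec_nth)
    fix e :: real assume e: "e > 0"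
    obtain d where d: "d > 0" and ap: "\<And>v. (\<Sum>i\<in>UNIV. \<bar>v $ i\<bar>) < d \<Longrightarrow>
      \<bar>G (x + (\<Sum>i\<in>UNIV. (v $ i) *\<^sub>R axis i 1)) - G x - (\<Sum>i\<in>UNIV. v $ i * P i x)\<bar>
        \<le> e / ?N * (\<Sum>i\<in>UNIV. \<bar>v $ i\<bar>)"
      using approx[of "e / ?N" UNIV] e N by (auto simp del: of_nat_eq_0_iff)
    show "\<exists>d>0. \<forall>y. norm (y - x) < d \<longrightarrow>
        norm (G y - G x - (\<Sum>i\<in>UNIV. (y - x) $ i * P i x)) \<le> e * norm (y - x)"
    proof (intro exI[of _ "d / ?N"] conjI allI impI)
      fix y :: "real^'m" assume y: "norm (y - x) < d / ?N"
      have "(\<Sum>i\<in>UNIV. \<bar>(y - x) $ i\<bar>) < d"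
        using l1[of "y - x"] y N by (simp add: field_simps)
      moreover have "(\<Sum>i\<in>UNIV. ((y - x) $ i) *\<^sub>R axis i 1) = y - x"
        using basis_expansion[of "y - x"] by (simp add: scalar_mult_eq_scaleR)
      ultimately have "\<bar>G y - G x - (\<Sum>i\<in>UNIV. (y - x) $ i * P i x)\<bar> \<le> e / ?N * (\<Sum>i\<in>UNIV. \<bar>(y - x) $ i\<bar>)"
        using ap[of "y - x"] by simp
      also have "\<dots> \<le> e / ?N * (?N * norm (y - x))"
        using e N by (intro mult_left_mono l1) auto
      also have "\<dots> = e * norm (y - x)" using N by simp
      finally show "norm (G y - G x - (\<Sum>i\<in>UNIV. (y - x) $ i * P i x)) \<le> e * norm (y - x)" by simp
    qed (use d N in simp)
  qed
qed

lemma partials_simps: "partials [] g = g" "partials (i # is) g = partial i (partials is g)"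
  by (simp_all add: partials_def)

lemma C_class_partials:
  assumes "C_class r g" 
  shows "length is \<le> r \<Longrightarrow> continuous_on UNIV (partials is g)"
    and "length is < r \<Longrightarrow> ((\<lambda>t. partials is g (x + t *\<^sub>R axis i 1)) has_real_derivative partials (i # is) g x) (at 0)"
    and "length is < r \<Longrightarrow> (partials is g has_derivative (\<lambda>v. \<Sum>i\<in>UNIV. v $ i * partials (i # is) g x)) (at x)"
proof -
  show c: "continuous_on UNIV (partials is g)" if "length is \<le> r" for "is"
    using assms that by (simp add: C_class_def)
  show d: "((\<lambda>t. partials is g (x + t *\<^sub>R axis i 1)) has_real_derivative partials (i # is) g x) (at 0)"
    if "length is < r" for i x
    using assms that unfolding C_class_def partials_simps partial_def DERIV_deriv_iff_real_differentiable by blast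
  show "(partials is g has_derivative (\<lambda>v. \<Sum>i\<in>UNIV. v $ i * partials (i # is) g x)) (at x)" if "length is < r"
    by (rule has_derivative_if_continuous_partials) (use d c that in auto)
qed

section \<open>Partial derivatives bounded by operator norms\<close>

lemma M_sup_nonneg: "0 \<le> M_sup r g"
proof -
  have "0 \<le> ereal \<bar>D_form r g 0 (replicate r (axis undefined 1))\<bar>" by simp
  also have "\<dots> \<le> form_op_norm r (D_form r g 0)"
    unfolding form_op_norm_def by (rule SUP_upper) (auto simp: norm_axis_1)
  also have "\<dots> \<le> M_sup r g" unfolding M_sup_def by (rule SUP_upper) auto
  finally show ?thesis .
qed

text \<open>Evaluated at axis vectors, the form collapses to a single partial derivative.\<close>

lemma abs_partials_le_M_sup:
  fixes g :: "real^'m::finite \<Rightarrow> real"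
  shows "ereal \<bar>partials is g x\<bar> \<le> M_sup (length is) g"
proof -
  let ?us = "map (\<lambda>i. axis i (1::real)) is"
  have "D_form (length is) g x ?us = (\<Sum>js | length js = length is. if js = is then partials is g x else 0)"
    unfolding D_form_def
  proof (rule sum.cong[OF refl])
    fix js :: "'m list" assume js: "js \<in> {js. length js = length is}"
    show "partials js g x * (\<Prod>j<length is. ?us ! j $ js ! j) = (if js = is then partials is g x else 0)"
    proof (cases "js = is")
      case False
      then obtain j where "j < length is" "js ! j \<noteq> is ! j" using js nth_equalityI[of js "is"] by auto
      then have "(\<Prod>j<length is. ?us ! j $ js ! j) = 0"
        by (intro prod_zero bexI[of _ j]) (simp_all add: axis_def)
      then show ?thesis using False by simp
    qed (simp add: axis_def)
  qed
  also have "\<dots> = partials is g x"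
    using finite_lists_length_eq[OF finite, of "UNIV :: 'm set" "length is"] by (simp add: sum.delta)
  finally have "ereal \<bar>partials is g x\<bar> = ereal \<bar>D_form (length is) g x ?us\<bar>" by simp
  also have "\<dots> \<le> form_op_norm (length is) (D_form (length is) g x)"
    unfolding form_op_norm_def by (rule SUP_upper) (auto simp: norm_axis_1)
  also have "\<dots> \<le> M_sup (length is) g" unfolding M_sup_def by (rule SUP_upper) auto
  finally show ?thesis .
qed

section \<open>Interpolation between a multilinear polynomial map and a Gaussian vector\<close>

lemma borel_measurable_vec_lambda:
  fixes f :: "'m::finite \<Rightarrow> 'a \<Rightarrow> real"
  assumes "\<And>j. f j \<in> borel_measurable M"
  shows "(\<lambda>x. \<chi> j. f j x) \<in> borel_measurable M"
proof (rule borel_measurable_euclidean_space[THEN iffD2], rule ballI)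
  fix b :: "real^'m" assume "b \<in> Basis"
  then obtain i where "b = axis i 1" by (auto simp: Basis_vec_def)
  then show "(\<lambda>x. (\<chi> j. f j x) \<bullet> b) \<in> borel_measurable M"
    using assms[of i] by (simp add: inner_axis)
qed

lemma has_real_derivative_compose_vec:
  fixes G :: "real^'m::finite \<Rightarrow> real"
  assumes "(G has_derivative (\<lambda>v. \<Sum>j\<in>UNIV. v $ j * P j)) (at (u t))"
    and "(u has_vector_derivative u') (at t)"
  shows "((\<lambda>t. G (u t)) has_real_derivative (\<Sum>j\<in>UNIV. u' $ j * P j)) (at t)"
proof -
  have "(\<lambda>s. \<Sum>j\<in>UNIV. (s *\<^sub>R u') $ j * P j) = (*) (\<Sum>j\<in>UNIV. u' $ j * P j)"
    by (auto simp: fun_eq_iff sum_distrib_left mult_ac)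
  then show ?thesis
    using has_derivative_compose[OF assms(2)[unfolded has_vector_derivative_def] assms(1)]
    by (simp add: has_field_derivative_def)
qed

text \<open>Mean value inequality on the segment from 0 to \<open>u\<close>. Applied twice, it turns
  bounded second partials into linear growth of the gradient and quadratic growth of
  \<open>g\<close>, hence integrability.\<close>

lemma abs_diff_le_sum_partials:
  fixes G :: "real^'m::finite \<Rightarrow> real"
  assumes "\<And>u. (G has_derivative (\<lambda>v. \<Sum>j\<in>UNIV. v $ j * P j u)) (at u)"
    and "\<And>t j. 0 \<le> t \<Longrightarrow> t \<le> 1 \<Longrightarrow> \<bar>P j (t *\<^sub>R u)\<bar> \<le> B j"
  shows "\<bar>G u - G 0\<bar> \<le> (\<Sum>j\<in>UNIV. \<bar>u $ j\<bar> * B j)"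
proof -
  have "norm (G (1 *\<^sub>R u) - G (0 *\<^sub>R u)) \<le> (\<Sum>j\<in>UNIV. \<bar>u $ j\<bar> * B j) * norm (1 - 0 :: real)"
  proof (rule field_differentiable_bound)
    fix t :: real assume t: "t \<in> {0..1}"
    have "((\<lambda>t. t *\<^sub>R u) has_vector_derivative u) (at t)"
      by (auto intro!: derivative_eq_intros)
    from has_real_derivative_compose_vec[OF assms(1) this]
    show "((\<lambda>t. G (t *\<^sub>R u)) has_real_derivative (\<Sum>j\<in>UNIV. u $ j * P j (t *\<^sub>R u))) (at t within {0..1})"
      by (rule DERIV_subset) simp
    have "\<bar>u $ j * P j (t *\<^sub>R u)\<bar> \<le> \<bar>u $ j\<bar> * B j" for j
      using assms(2)[of t j] t by (simp add: abs_mult mult_left_mono)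
    then show "norm (\<Sum>j\<in>UNIV. u $ j * P j (t *\<^sub>R u)) \<le> (\<Sum>j\<in>UNIV. \<bar>u $ j\<bar> * B j)"
      unfolding real_norm_def by (intro order_trans[OF sum_abs] sum_mono)
  qed auto
  then show ?thesis by simp
qed

text \<open>The mean value inequality bounds the difference quotients by \<open>R\<close>, which is
  free of \<open>\<theta>\<close>, so dominated convergence applies.\<close>

lemma has_real_derivative_integral:
  fixes f f' :: "real \<Rightarrow> 'a \<Rightarrow> real"
  assumes f: "\<And>\<theta>. integrable M (f \<theta>)" and f': "f' \<theta>\<^sub>0 \<in> borel_measurable M"
    and deriv: "\<And>x \<theta>. ((\<lambda>\<theta>. f \<theta> x) has_real_derivative f' \<theta> x) (at \<theta>)"
    and bd: "\<And>x \<theta>. \<bar>f' \<theta> x\<bar> \<le> R x" and R: "integrable M R"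
  shows "((\<lambda>\<theta>. \<integral>x. f \<theta> x \<partial>M) has_real_derivative (\<integral>x. f' \<theta>\<^sub>0 x \<partial>M)) (at \<theta>\<^sub>0)"
  unfolding has_field_derivative_iff tendsto_at_iff_sequentially
proof (intro allI impI)
  fix X :: "nat \<Rightarrow> real" assume X: "\<forall>i. X i \<in> UNIV - {\<theta>\<^sub>0}" "X \<longlonglongrightarrow> \<theta>\<^sub>0"
  let ?q = "\<lambda>i x. (f (X i) x - f \<theta>\<^sub>0 x) / (X i - \<theta>\<^sub>0)"
  have "(\<lambda>i. \<integral>x. ?q i x \<partial>M) \<longlonglongrightarrow> (\<integral>x. f' \<theta>\<^sub>0 x \<partial>M)"
  proof (rule integral_dominated_convergence[OF f' _ R])
    show "?q i \<in> borel_measurable M" for i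
      using f[THEN borel_measurable_integrable] by (intro borel_measurable_divide borel_measurable_diff) auto
    show "AE x in M. (\<lambda>i. ?q i x) \<longlonglongrightarrow> f' \<theta>\<^sub>0 x"
    proof (rule AE_I2)
      fix x
      show "(\<lambda>i. ?q i x) \<longlonglongrightarrow> f' \<theta>\<^sub>0 x"
        using deriv[of x \<theta>\<^sub>0] X unfolding has_field_derivative_iff tendsto_at_iff_sequentially
        by (auto simp: o_def)
    qed
    show "AE x in M. norm (?q i x) \<le> R x" for i
    proof (rule AE_I2)
      fix x
      have "norm (f (X i) x - f \<theta>\<^sub>0 x) \<le> R x * norm (X i - \<theta>\<^sub>0)"
        by (rule field_differentiable_bound[OF convex_UNIV]) (auto intro: deriv simp: bd)
      then show "norm (?q i x) \<le> R x" using X(1) by (simp add: divide_le_eq)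
    qed
  qed
  moreover have "(\<integral>x. ?q i x \<partial>M) = ((\<integral>x. f (X i) x \<partial>M) - (\<integral>x. f \<theta>\<^sub>0 x \<partial>M)) / (X i - \<theta>\<^sub>0)" for i
    by (simp add: f)
  ultimately show "((\<lambda>y. ((\<integral>x. f y x \<partial>M) - (\<integral>x. f \<theta>\<^sub>0 x \<partial>M)) / (y - \<theta>\<^sub>0)) \<circ> X) \<longlonglongrightarrow> (\<integral>x. f' \<theta>\<^sub>0 x \<partial>M)"
    by (simp only: o_def)
qed

text \<open>\<open>W_upd\<close> and \<open>D_upd\<close> encode multilinearity without naming a
  polynomial: \<open>W j\<close> is affine in each coordinate of \<open>V\<close>, with a slope free
  of that coordinate. The coordinates \<open>\<zeta> j\<close> lie outside \<open>V\<close>, so they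
  model a Gaussian vector independent of \<open>W\<close>.\<close>

locale gaussian_interpolation =
  fixes I V :: "'i set" and \<zeta> :: "'m::finite \<Rightarrow> 'i"
    and W :: "'m \<Rightarrow> ('i \<Rightarrow> real) \<Rightarrow> real" and D :: "'m \<Rightarrow> 'i \<Rightarrow> ('i \<Rightarrow> real) \<Rightarrow> real"
    and L :: "'m \<Rightarrow> real" and g :: "real^'m \<Rightarrow> real"
    and G :: "'m \<Rightarrow> real^'m \<Rightarrow> real" and H :: "'m \<Rightarrow> 'm \<Rightarrow> real^'m \<Rightarrow> real" and M :: real
  assumes finite_I: "finite I" and V_I: "V \<subseteq> I" and inj_\<zeta>: "inj \<zeta>" and \<zeta>_in: "\<zeta> j \<in> I" and \<zeta>_notin: "\<zeta> j \<notin> V"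
    and W_upd: "a \<in> V \<Longrightarrow> W j (x(a := t)) = W j x + (t - x a) * D j a x"
    and W_upd_notin: "a \<notin> V \<Longrightarrow> W j (x(a := t)) = W j x"
    and D_upd: "a \<in> V \<Longrightarrow> D j a (x(a := t)) = D j a x"
    and euler: "(\<Sum>a\<in>V. x a * D j a x) = L j * W j x" and L_pos: "L j > 0"
    and W_moments: "all_moments (std_gaussian I) (W j)"
    and D_moments: "a \<in> V \<Longrightarrow> all_moments (std_gaussian I) (D j a)"
    and g_deriv: "\<And>u. (g has_derivative (\<lambda>v. \<Sum>i\<in>UNIV. v $ i * G i u)) (at u)"
    and G_deriv: "\<And>i u. (G i has_derivative (\<lambda>v. \<Sum>j\<in>UNIV. v $ j * H j i u)) (at u)"
    and H_cont: "continuous_on UNIV (H j i)" and H_bound: "\<bar>H j i u\<bar> \<le> M"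
begin

abbreviation "\<gamma> \<equiv> std_gaussian I"

definition "Wv x = (\<chi> j. W j x)"
definition "Zv x = (\<chi> j. (x :: 'i \<Rightarrow> real) (\<zeta> j))"
definition "Dv a x = (\<chi> j. D j a x)"
text \<open>An angle, rather than weights sqrt t and sqrt (1 - t), keeps the derivative in the
  parameter under control up to both endpoints.\<close>

definition "U \<theta> x = sin \<theta> *\<^sub>R Wv x + cos \<theta> *\<^sub>R Zv x"
text \<open>Bounds the 1-norm of \<open>U \<theta> x\<close> uniformly in \<open>\<theta>\<close>;
  the integrable majorants are built from it.\<close>

definition "R x = (\<Sum>j\<in>UNIV. \<bar>W j x\<bar> + \<bar>x (\<zeta> j)\<bar>)"

lemma prob: "prob_space \<gamma>"
  by (rule prob_space_std_gaussian)

lemmas moments = all_moments_add all_moments_mult all_moments_sum[OF prob] all_moments_const[OF prob]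
  all_moments_abs W_moments D_moments all_moments_coord

lemma R_moments: "all_moments \<gamma> R"
  unfolding R_def[abs_def] by (intro moments \<zeta>_in)

lemma M_nonneg: "0 \<le> M"
  using H_bound[of undefined undefined 0] by linarith

lemma G_bound: "\<bar>G i u\<bar> \<le> \<bar>G i 0\<bar> + M * (\<Sum>j\<in>UNIV. \<bar>u $ j\<bar>)"
proof -
  have "\<bar>G i u - G i 0\<bar> \<le> (\<Sum>j\<in>UNIV. \<bar>u $ j\<bar> * M)"
    by (rule abs_diff_le_sum_partials[OF G_deriv H_bound])
  then show ?thesis by (simp add: sum_distrib_right mult.commute[of M])
qed

lemma g_bound: "\<bar>g u\<bar> \<le> \<bar>g 0\<bar> + (\<Sum>i\<in>UNIV. \<bar>u $ i\<bar> * (\<bar>G i 0\<bar> + M * (\<Sum>j\<in>UNIV. \<bar>u $ j\<bar>)))"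
proof -
  have "\<bar>G i (t *\<^sub>R u)\<bar> \<le> \<bar>G i 0\<bar> + M * (\<Sum>j\<in>UNIV. \<bar>u $ j\<bar>)" if "0 \<le> t" "t \<le> 1" for t i
  proof -
    have "\<bar>G i (t *\<^sub>R u)\<bar> \<le> \<bar>G i 0\<bar> + M * (\<Sum>j\<in>UNIV. \<bar>(t *\<^sub>R u) $ j\<bar>)" by (rule G_bound)
    also have "\<dots> \<le> \<bar>G i 0\<bar> + M * (\<Sum>j\<in>UNIV. \<bar>u $ j\<bar>)"
      using that by (intro add_left_mono mult_left_mono sum_mono M_nonneg) (auto simp: abs_mult mult_left_le_one_le)
    finally show ?thesis .
  qed
  from abs_diff_le_sum_partials[OF g_deriv this] show ?thesis by fastforce
qed

lemma abs_U_le: "\<bar>U \<theta> x $ j\<bar> \<le> \<bar>W j x\<bar> + \<bar>x (\<zeta> j)\<bar>"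
proof -
  have "\<bar>U \<theta> x $ j\<bar> \<le> \<bar>sin \<theta> * W j x\<bar> + \<bar>cos \<theta> * x (\<zeta> j)\<bar>"
    unfolding U_def Wv_def Zv_def by (simp add: abs_triangle_ineq)
  also have "\<dots> \<le> \<bar>W j x\<bar> + \<bar>x (\<zeta> j)\<bar>"
    by (intro add_mono) (auto simp: abs_mult mult_left_le_one_le)
  finally show ?thesis .
qed

lemma sum_abs_U_le: "(\<Sum>j\<in>UNIV. \<bar>U \<theta> x $ j\<bar>) \<le> R x"
  unfolding R_def by (intro sum_mono abs_U_le)

lemma U_measurable: "U \<theta> \<in> borel_measurable \<gamma>"
proof -
  have "Wv \<in> borel_measurable \<gamma>" unfolding Wv_def[abs_def]
    by (intro borel_measurable_vec_lambda all_moments_measurable[OF W_moments])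
  moreover have "Zv \<in> borel_measurable \<gamma>" unfolding Zv_def[abs_def]
    by (intro borel_measurable_vec_lambda measurable_coord \<zeta>_in)
  ultimately show ?thesis unfolding U_def[abs_def]
    by (intro borel_measurable_add borel_measurable_scaleR borel_measurable_const)
qed

lemma continuous_U_measurable:
  "continuous_on UNIV f \<Longrightarrow> (\<lambda>x. f (U \<theta> x) :: real) \<in> borel_measurable \<gamma>"
  using measurable_compose[OF U_measurable borel_measurable_continuous_onI] by blast

lemma g_cont: "continuous_on UNIV g" and G_cont: "continuous_on UNIV (G i)"
  using has_derivative_continuous[OF g_deriv] has_derivative_continuous[OF G_deriv]
  by (auto intro!: continuous_at_imp_continuous_on)

lemma H_moments: "all_moments \<gamma> (\<lambda>x. H j i (U \<theta> x))"
  by (rule all_moments_bound[OF all_moments_const[OF prob, of M] continuous_U_measurable[OF H_cont]])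
    (rule H_bound)

lemma G_bound_R: "\<bar>G i (U \<theta> x)\<bar> \<le> \<bar>G i 0\<bar> + M * R x"
  by (rule order_trans[OF G_bound]) (intro add_left_mono mult_left_mono sum_abs_U_le M_nonneg)

lemma G_moments: "all_moments \<gamma> (\<lambda>x. G i (U \<theta> x))"
  by (rule all_moments_bound[OF _ continuous_U_measurable[OF G_cont] G_bound_R])
    (intro moments R_moments)

lemma g_moments: "all_moments \<gamma> (\<lambda>x. g (U \<theta> x))"
proof (rule all_moments_bound[OF _ continuous_U_measurable[OF g_cont]])
  show "all_moments \<gamma> (\<lambda>x. \<bar>g 0\<bar> + (\<Sum>i\<in>UNIV. R x * (\<bar>G i 0\<bar> + M * R x)))"
    by (intro moments R_moments)
  fix x
  have "\<bar>g (U \<theta> x)\<bar> \<le> \<bar>g 0\<bar> + (\<Sum>i\<in>UNIV. \<bar>U \<theta> x $ i\<bar> * (\<bar>G i 0\<bar> + M * (\<Sum>j\<in>UNIV. \<bar>U \<theta> x $ j\<bar>)))"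
    by (rule g_bound)
  also have "\<dots> \<le> \<bar>g 0\<bar> + (\<Sum>i\<in>UNIV. R x * (\<bar>G i 0\<bar> + M * R x))"
  proof (intro add_left_mono sum_mono mult_mono mult_left_mono sum_abs_U_le M_nonneg)
    show "\<bar>U \<theta> x $ i\<bar> \<le> R x" for i
      by (rule order_trans[OF member_le_sum[of i UNIV "\<lambda>j. \<bar>U \<theta> x $ j\<bar>"] sum_abs_U_le]) auto
    then show "0 \<le> R x" by (meson abs_ge_zero order_trans)
  qed (auto intro!: add_nonneg_nonneg mult_nonneg_nonneg M_nonneg sum_nonneg)
  finally show "\<bar>g (U \<theta> x)\<bar> \<le> \<bar>g 0\<bar> + (\<Sum>i\<in>UNIV. R x * (\<bar>G i 0\<bar> + M * R x))" .
qed

section \<open>Integration by parts along the interpolation path\<close>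

lemma by_parts_W:
  assumes a: "a \<in> V"
  shows "(\<integral>x. x a * (D i a x * G i (U \<theta> x)) \<partial>\<gamma>)
    = sin \<theta> * (\<Sum>j\<in>UNIV. \<integral>x. D i a x * D j a x * H j i (U \<theta> x) \<partial>\<gamma>)"
proof -
  \<comment> \<open>The coordinates \<open>\<zeta> j\<close> differ from \<open>a \<in> V\<close>,
    so only the \<open>W\<close> part of \<open>U\<close> moves.\<close>
  have U_upd: "U \<theta> (x(a := t)) = U \<theta> x + ((t - x a) * sin \<theta>) *\<^sub>R Dv a x" for x t
    using \<zeta>_notin a unfolding U_def Wv_def Zv_def Dv_def
    by (auto simp: vec_eq_iff W_upd[OF a] algebra_simps)
  let ?f' = "\<lambda>x. D i a x * (\<Sum>j\<in>UNIV. (sin \<theta> * D j a x) * H j i (U \<theta> x))"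
  have "(\<integral>x. x a * (D i a x * G i (U \<theta> x)) \<partial>\<gamma>) = (\<integral>x. ?f' x \<partial>\<gamma>)"
  proof (rule std_gaussian_by_parts[OF finite_I])
    show "a \<in> I" using a V_I by blast
    show "integrable \<gamma> (\<lambda>x. x a * (D i a x * G i (U \<theta> x)))" "integrable \<gamma> ?f'"
      using a V_I by (auto intro!: all_moments_integrable moments G_moments H_moments)
    fix x
    have u: "((\<lambda>t. U \<theta> (x(a := t))) has_vector_derivative sin \<theta> *\<^sub>R Dv a x) (at t)" for t
      unfolding U_upd by (auto intro!: derivative_eq_intros)
    show "((\<lambda>t. D i a (x(a := t)) * G i (U \<theta> (x(a := t)))) has_real_derivative ?f' (x(a := t))) (at t)" for t
      using DERIV_cmult[OF has_real_derivative_compose_vec[OF G_deriv u], of "D i a x" i t]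
      by (simp add: D_upd[OF a] Dv_def)
    have "continuous_on UNIV (\<lambda>t. U \<theta> (x(a := t)))"
      unfolding U_upd by (intro continuous_intros)
    then have H: "continuous_on UNIV (\<lambda>t. H j i (U \<theta> (x(a := t))))" for j
      by (rule continuous_on_compose2[OF H_cont]) auto
    show "continuous_on UNIV (\<lambda>t. ?f' (x(a := t)))"
      unfolding D_upd[OF a] by (intro continuous_intros H)
    have "\<bar>?f' (x(a := t))\<bar> \<le> \<bar>D i a x\<bar> * (\<Sum>j\<in>UNIV. \<bar>sin \<theta> * D j a x\<bar> * M)" for t
      unfolding D_upd[OF a] abs_mult[of "D i a x"]
      by (intro mult_left_mono order_trans[OF sum_abs] sum_mono)
        (auto simp: abs_mult intro!: mult_left_mono H_bound)
    then show "\<exists>B. \<forall>t. \<bar>?f' (x(a := t))\<bar> \<le> B" by blast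
  qed
  also have "\<dots> = (\<integral>x. sin \<theta> * (\<Sum>j\<in>UNIV. D i a x * D j a x * H j i (U \<theta> x)) \<partial>\<gamma>)"
    by (rule Bochner_Integration.integral_cong[OF refl]) (simp add: sum_distrib_left algebra_simps)
  also have "\<dots> = sin \<theta> * (\<Sum>j\<in>UNIV. \<integral>x. D i a x * D j a x * H j i (U \<theta> x) \<partial>\<gamma>)"
    using a by (subst Bochner_Integration.integral_sum[symmetric])
      (auto intro!: all_moments_integrable moments H_moments)
  finally show ?thesis .
qed

text \<open>Euler's identity supplies the explicit factor \<open>x a\<close> that integration by
  parts consumes. Its price is the division by \<open>L i\<close>, so the resulting matrix need not
  be symmetric in \<open>i\<close> and \<open>j\<close>.\<close>

lemma expectation_W:
  "(\<integral>x. W i x * G i (U \<theta> x) \<partial>\<gamma>)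
    = sin \<theta> * (\<Sum>j\<in>UNIV. \<integral>x. (\<Sum>a\<in>V. D i a x * D j a x) / L i * H j i (U \<theta> x) \<partial>\<gamma>)"
proof -
  have "(\<integral>x. W i x * G i (U \<theta> x) \<partial>\<gamma>) = (\<integral>x. (\<Sum>a\<in>V. x a * (D i a x * G i (U \<theta> x))) / L i \<partial>\<gamma>)"
  proof (rule Bochner_Integration.integral_cong[OF refl])
    fix x
    have "(\<Sum>a\<in>V. x a * (D i a x * G i (U \<theta> x))) = (\<Sum>a\<in>V. x a * D i a x) * G i (U \<theta> x)"
      by (simp add: sum_distrib_right mult.assoc)
    then show "W i x * G i (U \<theta> x) = (\<Sum>a\<in>V. x a * (D i a x * G i (U \<theta> x))) / L i"
      using L_pos[of i] by (simp add: euler)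
  qed
  also have "\<dots> = (\<Sum>a\<in>V. \<integral>x. x a * (D i a x * G i (U \<theta> x)) \<partial>\<gamma>) / L i"
    using V_I by (simp, subst Bochner_Integration.integral_sum)
      (auto intro!: all_moments_integrable moments G_moments)
  also have "\<dots> = (\<Sum>a\<in>V. sin \<theta> * (\<Sum>j\<in>UNIV. \<integral>x. D i a x * D j a x * H j i (U \<theta> x) \<partial>\<gamma>)) / L i"
    by (simp add: by_parts_W)
  also have "\<dots> = sin \<theta> * (\<Sum>j\<in>UNIV. (\<Sum>a\<in>V. \<integral>x. D i a x * D j a x * H j i (U \<theta> x) \<partial>\<gamma>) / L i)"
    by (simp add: sum_distrib_left[symmetric] sum_divide_distrib[symmetric], subst sum.swap, simp)
  also have "\<dots> = sin \<theta> * (\<Sum>j\<in>UNIV. \<integral>x. (\<Sum>a\<in>V. D i a x * D j a x) / L i * H j i (U \<theta> x) \<partial>\<gamma>)"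
  proof -
    have "(\<Sum>a\<in>V. \<integral>x. D i a x * D j a x * H j i (U \<theta> x) \<partial>\<gamma>) / L i
        = (\<integral>x. (\<Sum>a\<in>V. D i a x * D j a x) / L i * H j i (U \<theta> x) \<partial>\<gamma>)" for j
    proof -
      have "(\<Sum>a\<in>V. \<integral>x. D i a x * D j a x * H j i (U \<theta> x) \<partial>\<gamma>)
          = (\<integral>x. (\<Sum>a\<in>V. D i a x * D j a x * H j i (U \<theta> x)) \<partial>\<gamma>)"
        by (subst Bochner_Integration.integral_sum) (auto intro!: all_moments_integrable moments H_moments)
      then show ?thesis by (simp add: sum_distrib_right flip: integral_divide_zero)
    qed
    then show ?thesis by (simp only:)
  qed
  finally show ?thesis .
qed

text \<open>\<open>W\<close> does not see the coordinate \<open>\<zeta> i\<close> and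
  \<open>\<zeta>\<close> is injective, so \<open>U\<close> moves along axis \<open>i\<close> alone
  and only a diagonal second partial survives.\<close>

lemma expectation_Z:
  "(\<integral>x. x (\<zeta> i) * G i (U \<theta> x) \<partial>\<gamma>) = cos \<theta> * (\<integral>x. H i i (U \<theta> x) \<partial>\<gamma>)"
proof -
  have U_upd: "U \<theta> (x(\<zeta> i := t)) = U \<theta> x + ((t - x (\<zeta> i)) * cos \<theta>) *\<^sub>R axis i 1" for x t
    using inj_\<zeta> unfolding U_def Wv_def Zv_def
    by (auto simp: vec_eq_iff W_upd_notin[OF \<zeta>_notin] axis_def algebra_simps inj_eq)
  have "(\<integral>x. x (\<zeta> i) * G i (U \<theta> x) \<partial>\<gamma>) = (\<integral>x. cos \<theta> * H i i (U \<theta> x) \<partial>\<gamma>)"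
  proof (rule std_gaussian_by_parts[OF finite_I \<zeta>_in])
    show "integrable \<gamma> (\<lambda>x. x (\<zeta> i) * G i (U \<theta> x))" "integrable \<gamma> (\<lambda>x. cos \<theta> * H i i (U \<theta> x))"
      by (auto intro!: all_moments_integrable moments G_moments H_moments \<zeta>_in)
    fix x
    have u: "((\<lambda>t. U \<theta> (x(\<zeta> i := t))) has_vector_derivative cos \<theta> *\<^sub>R axis i 1) (at t)" for t
      unfolding U_upd by (auto intro!: derivative_eq_intros)
    have "(\<Sum>j\<in>UNIV. (cos \<theta> *\<^sub>R axis i 1) $ j * H j i u) = cos \<theta> * H i i u" for u
      by (simp add: axis_def if_distrib[of "\<lambda>c. c * _"] if_distrib[of "\<lambda>c. _ * c"] cong: if_cong)
    then show "((\<lambda>t. G i (U \<theta> (x(\<zeta> i := t)))) has_real_derivative cos \<theta> * H i i (U \<theta> (x(\<zeta> i := t)))) (at t)" for t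
      using has_real_derivative_compose_vec[OF G_deriv u, of i t] by simp
    have "continuous_on UNIV (\<lambda>t. U \<theta> (x(\<zeta> i := t)))"
      unfolding U_upd by (intro continuous_intros)
    then have H: "continuous_on UNIV (\<lambda>t. H i i (U \<theta> (x(\<zeta> i := t))))"
      by (rule continuous_on_compose2[OF H_cont]) auto
    show "continuous_on UNIV (\<lambda>t. cos \<theta> * H i i (U \<theta> (x(\<zeta> i := t))))"
      by (intro continuous_intros H)
    have "\<bar>cos \<theta> * H i i (U \<theta> (x(\<zeta> i := t)))\<bar> \<le> \<bar>cos \<theta>\<bar> * M" for t
      unfolding abs_mult by (intro mult_left_mono H_bound) auto
    then show "\<exists>B. \<forall>t. \<bar>cos \<theta> * H i i (U \<theta> (x(\<zeta> i := t)))\<bar> \<le> B" by blast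
  qed
  then show ?thesis by simp
qed

text \<open>The quantity <-D L^(-1) W_i, D W_j> - \<delta>_ij of the Malliavin-Stein method, with L
  the Ornstein-Uhlenbeck operator: on the Gaussian chaos of order \<open>L i\<close>, its negative
  inverse divides by \<open>L i\<close>.\<close>

definition "discrepancy i j x = (\<Sum>a\<in>V. D i a x * D j a x) / L i - (if i = j then 1 else 0)"

lemma discrepancy_moments: "all_moments \<gamma> (discrepancy i j)"
  unfolding discrepancy_def[abs_def] diff_conv_add_uminus divide_inverse by (intro moments)

text \<open>The derivative of the path is cos \<theta> W - sin \<theta> Z. Integration by parts
  brings sin \<theta> from the first part and cos \<theta> from the second, so both share one
  prefactor, and the second part subtracts exactly the identity matrix.\<close>

lemma derivative_expectation:
  "((\<lambda>\<theta>. \<integral>x. g (U \<theta> x) \<partial>\<gamma>) has_real_derivative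
     sin \<theta> * cos \<theta> * (\<Sum>i\<in>UNIV. \<Sum>j\<in>UNIV. \<integral>x. discrepancy i j x * H j i (U \<theta> x) \<partial>\<gamma>)) (at \<theta>)"
proof -
  let ?f' = "\<lambda>\<theta> x. \<Sum>i\<in>UNIV. (cos \<theta> * W i x - sin \<theta> * x (\<zeta> i)) * G i (U \<theta> x)"
  have "((\<lambda>\<theta>. \<integral>x. g (U \<theta> x) \<partial>\<gamma>) has_real_derivative (\<integral>x. ?f' \<theta> x \<partial>\<gamma>)) (at \<theta>)"
  proof (rule has_real_derivative_integral)
    show "integrable \<gamma> (\<lambda>x. g (U \<theta> x))" for \<theta> by (rule all_moments_integrable[OF g_moments])
    show "?f' \<theta> \<in> borel_measurable \<gamma>"
      unfolding diff_conv_add_uminus minus_mult_left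
      by (rule all_moments_measurable) (intro moments G_moments \<zeta>_in)
    show "((\<lambda>\<theta>. g (U \<theta> x)) has_real_derivative ?f' \<theta> x) (at \<theta>)" for x \<theta>
    proof -
      have "((\<lambda>\<theta>. U \<theta> x) has_vector_derivative cos \<theta> *\<^sub>R Wv x - sin \<theta> *\<^sub>R Zv x) (at \<theta>)"
        unfolding U_def by (auto intro!: derivative_eq_intros)
      from has_real_derivative_compose_vec[OF g_deriv this] show ?thesis
        by (simp add: Wv_def Zv_def)
    qed
    show "integrable \<gamma> (\<lambda>x. \<Sum>i\<in>UNIV. (\<bar>W i x\<bar> + \<bar>x (\<zeta> i)\<bar>) * (\<bar>G i 0\<bar> + M * R x))"
      by (rule all_moments_integrable) (intro moments R_moments \<zeta>_in)
    fix \<theta> x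
    have "\<bar>(cos \<theta> * W i x - sin \<theta> * x (\<zeta> i)) * G i (U \<theta> x)\<bar> \<le> (\<bar>W i x\<bar> + \<bar>x (\<zeta> i)\<bar>) * (\<bar>G i 0\<bar> + M * R x)" for i
      unfolding abs_mult
    proof (intro mult_mono G_bound_R)
      have "\<bar>cos \<theta> * W i x - sin \<theta> * x (\<zeta> i)\<bar> \<le> \<bar>cos \<theta> * W i x\<bar> + \<bar>sin \<theta> * x (\<zeta> i)\<bar>" by (rule abs_triangle_ineq4)
      also have "\<dots> \<le> \<bar>W i x\<bar> + \<bar>x (\<zeta> i)\<bar>"
        by (intro add_mono) (auto simp: abs_mult mult_left_le_one_le)
      finally show "\<bar>cos \<theta> * W i x - sin \<theta> * x (\<zeta> i)\<bar> \<le> \<bar>W i x\<bar> + \<bar>x (\<zeta> i)\<bar>" .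
    qed auto
    then show "\<bar>?f' \<theta> x\<bar> \<le> (\<Sum>i\<in>UNIV. (\<bar>W i x\<bar> + \<bar>x (\<zeta> i)\<bar>) * (\<bar>G i 0\<bar> + M * R x))"
      by (intro order_trans[OF sum_abs] sum_mono)
  qed
  moreover have "(\<integral>x. ?f' \<theta> x \<partial>\<gamma>) = sin \<theta> * cos \<theta> * (\<Sum>i\<in>UNIV. \<Sum>j\<in>UNIV. \<integral>x. discrepancy i j x * H j i (U \<theta> x) \<partial>\<gamma>)"
  proof -
    have iW: "integrable \<gamma> (\<lambda>x. W i x * G i (U \<theta> x))" and iZ: "integrable \<gamma> (\<lambda>x. x (\<zeta> i) * G i (U \<theta> x))" for i
      by (auto intro!: all_moments_integrable moments G_moments \<zeta>_in)
    have "(\<integral>x. ?f' \<theta> x \<partial>\<gamma>) = (\<integral>x. (\<Sum>i\<in>UNIV. cos \<theta> * (W i x * G i (U \<theta> x)) - sin \<theta> * (x (\<zeta> i) * G i (U \<theta> x))) \<partial>\<gamma>)"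
      by (simp add: algebra_simps)
    also have "\<dots> = (\<Sum>i\<in>UNIV. cos \<theta> * (\<integral>x. W i x * G i (U \<theta> x) \<partial>\<gamma>) - sin \<theta> * (\<integral>x. x (\<zeta> i) * G i (U \<theta> x) \<partial>\<gamma>))"
      using iW iZ by (subst Bochner_Integration.integral_sum) auto
    also have "\<dots> = (\<Sum>i\<in>UNIV. sin \<theta> * cos \<theta> * (\<Sum>j\<in>UNIV. \<integral>x. discrepancy i j x * H j i (U \<theta> x) \<partial>\<gamma>))"
    proof (rule sum.cong[OF refl])
      fix i
      let ?T = "\<lambda>j x. (\<Sum>a\<in>V. D i a x * D j a x) / L i"
      have "(\<integral>x. discrepancy i j x * H j i (U \<theta> x) \<partial>\<gamma>)
          = (\<integral>x. ?T j x * H j i (U \<theta> x) \<partial>\<gamma>) - (if i = j then \<integral>x. H j i (U \<theta> x) \<partial>\<gamma> else 0)" for j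
      proof -
        have "integrable \<gamma> (\<lambda>x. ?T j x * H j i (U \<theta> x))" "integrable \<gamma> (\<lambda>x. H j i (U \<theta> x))"
          unfolding divide_inverse by (auto intro!: all_moments_integrable moments H_moments)
        then show ?thesis unfolding discrepancy_def by (simp add: left_diff_distrib)
      qed
      then have "(\<Sum>j\<in>UNIV. \<integral>x. discrepancy i j x * H j i (U \<theta> x) \<partial>\<gamma>)
          = (\<Sum>j\<in>UNIV. \<integral>x. ?T j x * H j i (U \<theta> x) \<partial>\<gamma>) - (\<integral>x. H i i (U \<theta> x) \<partial>\<gamma>)"
        by (simp add: sum_subtractf)
      then show "cos \<theta> * (\<integral>x. W i x * G i (U \<theta> x) \<partial>\<gamma>) - sin \<theta> * (\<integral>x. x (\<zeta> i) * G i (U \<theta> x) \<partial>\<gamma>)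
          = sin \<theta> * cos \<theta> * (\<Sum>j\<in>UNIV. \<integral>x. discrepancy i j x * H j i (U \<theta> x) \<partial>\<gamma>)"
        unfolding expectation_W expectation_Z by (simp only: right_diff_distrib mult_ac)
    qed
    finally show ?thesis by (simp add: sum_distrib_left)
  qed
  ultimately show ?thesis by simp
qed

theorem interpolation_bound:
  "\<bar>(\<integral>x. g (\<chi> j. W j x) \<partial>\<gamma>) - (\<integral>x. g (\<chi> j. x (\<zeta> j)) \<partial>\<gamma>)\<bar>
     \<le> 2 * M * (\<Sum>i\<in>UNIV. \<Sum>j\<in>UNIV. \<integral>x. \<bar>discrepancy i j x\<bar> \<partial>\<gamma>)"
proof -
  let ?B = "M * (\<Sum>i\<in>UNIV. \<Sum>j\<in>UNIV. \<integral>x. \<bar>discrepancy i j x\<bar> \<partial>\<gamma>)"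
  have nn: "0 \<le> ?B" by (intro mult_nonneg_nonneg M_nonneg sum_nonneg integral_nonneg) auto
  have "\<bar>\<integral>x. discrepancy i j x * H j i (U \<theta> x) \<partial>\<gamma>\<bar> \<le> M * (\<integral>x. \<bar>discrepancy i j x\<bar> \<partial>\<gamma>)" for i j \<theta>
  proof -
    have "\<bar>\<integral>x. discrepancy i j x * H j i (U \<theta> x) \<partial>\<gamma>\<bar> \<le> (\<integral>x. \<bar>discrepancy i j x * H j i (U \<theta> x)\<bar> \<partial>\<gamma>)"
      using integral_norm_bound[of \<gamma> "\<lambda>x. discrepancy i j x * H j i (U \<theta> x)"] by simp
    also have "\<dots> \<le> (\<integral>x. M * \<bar>discrepancy i j x\<bar> \<partial>\<gamma>)"
    proof (rule integral_mono)
      show "integrable \<gamma> (\<lambda>x. \<bar>discrepancy i j x * H j i (U \<theta> x)\<bar>)" "integrable \<gamma> (\<lambda>x. M * \<bar>discrepancy i j x\<bar>)"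
        by (auto intro!: all_moments_integrable moments discrepancy_moments H_moments)
      show "\<bar>discrepancy i j x * H j i (U \<theta> x)\<bar> \<le> M * \<bar>discrepancy i j x\<bar>" for x
        unfolding abs_mult mult.commute[of M] by (intro mult_left_mono H_bound) auto
    qed
    finally show ?thesis by simp
  qed
  then have S: "\<bar>\<Sum>i\<in>UNIV. \<Sum>j\<in>UNIV. \<integral>x. discrepancy i j x * H j i (U \<theta> x) \<partial>\<gamma>\<bar> \<le> ?B" for \<theta>
    unfolding sum_distrib_left by (intro order_trans[OF sum_abs] sum_mono)
  have "norm ((\<integral>x. g (U (pi/2) x) \<partial>\<gamma>) - (\<integral>x. g (U 0 x) \<partial>\<gamma>)) \<le> ?B * norm (pi / 2 - 0)"
  proof (rule field_differentiable_bound[OF convex_UNIV])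
    show "((\<lambda>\<theta>. \<integral>x. g (U \<theta> x) \<partial>\<gamma>) has_real_derivative
     sin \<theta> * cos \<theta> * (\<Sum>i\<in>UNIV. \<Sum>j\<in>UNIV. \<integral>x. discrepancy i j x * H j i (U \<theta> x) \<partial>\<gamma>)) (at \<theta>)" for \<theta>
      by (rule derivative_expectation)
    fix \<theta> :: real
    have "\<bar>sin \<theta> * cos \<theta>\<bar> \<le> 1 * 1" unfolding abs_mult by (intro mult_mono) auto
    with S[of \<theta>] have "\<bar>sin \<theta> * cos \<theta>\<bar> * \<bar>\<Sum>i\<in>UNIV. \<Sum>j\<in>UNIV. \<integral>x. discrepancy i j x * H j i (U \<theta> x) \<partial>\<gamma>\<bar> \<le> 1 * ?B"
      by (intro mult_mono) auto
    then show "norm (sin \<theta> * cos \<theta> * (\<Sum>i\<in>UNIV. \<Sum>j\<in>UNIV. \<integral>x. discrepancy i j x * H j i (U \<theta> x) \<partial>\<gamma>)) \<le> ?B"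
      by (simp add: abs_mult)
  qed auto
  \<comment> \<open>The length of the interval, \<open>pi / 2\<close>, is at most 2; hence the
    constant in the statement.\<close>
  also have "\<dots> \<le> ?B * 2" using pi_half_less_two nn by (intro mult_left_mono) auto
  finally show ?thesis by (simp add: U_def Wv_def Zv_def algebra_simps)
qed

end

section \<open>Correlated pairs in sparse set systems\<close>

lemma card_Sigma_le:
  assumes "finite A" "card A \<le> m" "\<And>x. x \<in> A \<Longrightarrow> finite (B x) \<and> card (B x) \<le> c"
  shows "finite (Sigma A B) \<and> card (Sigma A B) \<le> m * c"
proof -
  have "card (Sigma A B) = (\<Sum>x\<in>A. card (B x))" using assms by (intro card_SigmaI) auto
  also have "\<dots> \<le> card A * c" using sum_bounded_above[of A "\<lambda>x. card (B x)" c] assms(3) by simp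
  also have "\<dots> \<le> m * c" using assms(2) by simp
  finally show ?thesis using assms by auto
qed

text \<open>Counting by successive choices: \<open>m\<close> ways for the first, then
  \<open>c\<close> for the rest. The map \<open>f\<close> reassembles the tuple, as the order of
  choice may differ from the order of components.\<close>

lemma card_image_Sigma_le:
  assumes "S \<subseteq> f ` Sigma A B" "finite A" "card A \<le> m" "\<And>x. x \<in> A \<Longrightarrow> finite (B x) \<and> card (B x) \<le> c"
  shows "finite S \<and> card S \<le> m * c"
proof -
  note * = card_Sigma_le[OF assms(2-4)]
  then have "finite (f ` Sigma A B)" "card (f ` Sigma A B) \<le> m * c"
    using card_image_le[of "Sigma A B" f] by (auto intro: le_trans)
  then show ?thesis using finite_subset[OF assms(1)] card_mono[OF _ assms(1)] by (auto intro: le_trans)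
qed

lemma card_UN_bounded:
  assumes "S \<subseteq> (\<Union>x\<in>A. B x)" "finite A" "card A \<le> m" "\<And>x. x \<in> A \<Longrightarrow> finite (B x) \<and> card (B x) \<le> c"
  shows "finite S \<and> card S \<le> m * c"
  by (rule card_image_Sigma_le[of S snd A B]) (use assms in force)+

lemma obtain_two:
  assumes "2 \<le> card B"
  obtains x y where "x \<in> B" "y \<in> B" "x \<noteq> y"
proof -
  obtain T where "T \<subseteq> B" "card T = 2" using obtain_subset_with_card_n[OF assms] by blast
  then show thesis using that unfolding card_2_iff by blast
qed

lemma obtain_other:
  assumes "2 \<le> card B"
  obtains y where "y \<in> B" "y \<noteq> x"
  using obtain_two[OF assms] by metis

text \<open>\<open>codegree\<close> isolates the arithmetic input: two vertices lie in boundedly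
  many sets. Sets are indexed by \<open>P\<close> because distinct indices may give the same set.
  The lower bound 3 leaves two vertices after one is removed, enough to apply
  \<open>codegree\<close>.\<close>

locale sparse_family =
  fixes V :: "'v set" and P :: "'p set" and A :: "'p \<Rightarrow> 'v set" and n k K :: nat
  assumes finite_V: "finite V" and card_V: "card V = n" and finite_P: "finite P"
    and A_V: "p \<in> P \<Longrightarrow> A p \<subseteq> V" and A_ge: "p \<in> P \<Longrightarrow> 3 \<le> card (A p)" and A_le: "p \<in> P \<Longrightarrow> card (A p) \<le> k"
    and codegree: "x \<noteq> y \<Longrightarrow> card {p \<in> P. x \<in> A p \<and> y \<in> A p} \<le> K"
begin

lemma finite_A: "p \<in> P \<Longrightarrow> finite (A p)"
  using A_V finite_V finite_subset by blast

lemma fin_A: "p \<in> P \<Longrightarrow> finite (A p) \<and> card (A p) \<le> k"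
  using finite_A A_le by blast

definition "star_at x = {p \<in> P. x \<in> A p}"
definition "meeting_twice X = {p \<in> P. \<exists>x y. x \<noteq> y \<and> x \<in> X \<inter> A p \<and> y \<in> X \<inter> A p}"

lemma meeting_twice_I: "p \<in> P \<Longrightarrow> x \<noteq> y \<Longrightarrow> x \<in> X \<Longrightarrow> y \<in> X \<Longrightarrow> x \<in> A p \<Longrightarrow> y \<in> A p \<Longrightarrow> p \<in> meeting_twice X"
  unfolding meeting_twice_def by blast

text \<open>Two of the \<open>m\<close> vertices, then at most \<open>K\<close> sets through both: a
  bound free of \<open>n\<close>.\<close>

lemma meeting_twice_le:
  assumes "finite X" "card X \<le> m"
  shows "finite (meeting_twice X) \<and> card (meeting_twice X) \<le> m * m * K"
proof (rule card_UN_bounded[of _ "\<lambda>(x, y). {p \<in> P. x \<noteq> y \<and> x \<in> A p \<and> y \<in> A p}" "X \<times> X"])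
  show "meeting_twice X \<subseteq> (\<Union>z\<in>X \<times> X. case z of (x, y) \<Rightarrow> {p \<in> P. x \<noteq> y \<and> x \<in> A p \<and> y \<in> A p})"
    unfolding meeting_twice_def by auto
  show "card (X \<times> X) \<le> m * m" using assms by (simp add: mult_le_mono)
  show "finite (case z of (x, y) \<Rightarrow> {p \<in> P. x \<noteq> y \<and> x \<in> A p \<and> y \<in> A p}) \<and>
      card (case z of (x, y) \<Rightarrow> {p \<in> P. x \<noteq> y \<and> x \<in> A p \<and> y \<in> A p}) \<le> K" for z
    using codegree finite_P by (cases z; cases "fst z = snd z") auto
qed (use assms in auto)

lemma star_at_le: "finite (star_at x) \<and> card (star_at x) \<le> n * K"
proof (rule card_UN_bounded[of _ "\<lambda>y. {p \<in> P. x \<in> A p \<and> y \<in> A p}" "V - {x}"])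
  show "star_at x \<subseteq> (\<Union>y\<in>V - {x}. {p \<in> P. x \<in> A p \<and> y \<in> A p})"
  proof
    fix p assume p: "p \<in> star_at x"
    then have "2 \<le> card (A p)" using A_ge[of p] by (simp add: star_at_def)
    then obtain y where "y \<in> A p" "y \<noteq> x" by (rule obtain_other)
    then show "p \<in> (\<Union>y\<in>V - {x}. {p \<in> P. x \<in> A p \<and> y \<in> A p})"
      using p A_V unfolding star_at_def by blast
  qed
  show "card (V - {x}) \<le> n" using card_V finite_V card_Diff1_le[of V x] by simp
qed (use finite_V finite_P codegree in auto)

lemma P_le: "finite P \<and> card P \<le> n * (n * K)"
proof (rule card_UN_bounded[of _ star_at V])
  show "P \<subseteq> (\<Union>x\<in>V. star_at x)"
  proof
    fix p assume p: "p \<in> P"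
    then have "2 \<le> card (A p)" using A_ge[of p] by simp
    then obtain y where "y \<in> A p" by (rule obtain_two)
    then show "p \<in> (\<Union>x\<in>V. star_at x)" using p A_V unfolding star_at_def by blast
  qed
qed (use star_at_le finite_V card_V in auto)

section \<open>Counting triples and correlated pairs of triples\<close>

definition "triples = {(a, p, q). p \<in> P \<and> q \<in> P \<and> a \<in> A p \<and> a \<in> A q}"
definition "tight_triples = {(a, p, q). p \<in> P \<and> q \<in> P \<and> a \<in> A p \<and> a \<in> A q \<and> (\<exists>x. x \<noteq> a \<and> x \<in> A p \<and> x \<in> A q)}"

lemma triples_le: "finite triples \<and> card triples \<le> n * (n * K * (n * K))"
proof (rule card_image_Sigma_le[of _ id V "\<lambda>a. star_at a \<times> star_at a"])
  show "triples \<subseteq> id ` (SIGMA a:V. star_at a \<times> star_at a)"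
    using A_V unfolding triples_def star_at_def by fastforce
  show "finite (star_at x \<times> star_at x) \<and> card (star_at x \<times> star_at x) \<le> n * K * (n * K)" for x
    using star_at_le[of x] by (simp add: mult_le_mono)
qed (use finite_V card_V in auto)

text \<open>A second common vertex forces \<open>q\<close> to meet \<open>A p\<close> twice. Given
  \<open>p\<close> and \<open>a\<close>, it then costs O(1) choices instead of O(n), which saves a
  factor \<open>n\<close> against \<open>triples_le\<close>.\<close>

lemma tight_triples_le: "finite tight_triples \<and> card tight_triples \<le> n * (n * K) * (k * (k * k * K))"
proof (rule card_image_Sigma_le[of _ "\<lambda>(p, a, q). (a, p, q)" P "\<lambda>p. SIGMA a:A p. meeting_twice (A p)"])
  show "tight_triples \<subseteq> (\<lambda>(p, a, q). (a, p, q)) ` (SIGMA p:P. SIGMA a:A p. meeting_twice (A p))"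
    unfolding tight_triples_def by (auto simp: image_iff intro: meeting_twice_I)
  show "finite (SIGMA a:A p. meeting_twice (A p)) \<and> card (SIGMA a:A p. meeting_twice (A p)) \<le> k * (k * k * K)" if "p \<in> P" for p
    by (rule card_Sigma_le) (use fin_A[OF that] meeting_twice_le in auto)
qed (use P_le in auto)

definition "support = (\<lambda>(a, p, q). A p \<union> A q)"

lemma support_le: "t \<in> triples \<Longrightarrow> finite (support t) \<and> card (support t) \<le> 2 * k"
proof -
  assume "t \<in> triples"
  then obtain a p q where t: "t = (a, p, q)" "p \<in> P" "q \<in> P" unfolding triples_def by auto
  then show ?thesis
    using fin_A[OF t(2)] fin_A[OF t(3)] card_Un_le[of "A p" "A q"] by (simp add: support_def)
qed

text \<open>For each of the \<open>O(n\<^sup>3)\<close> triples \<open>t\<close> there are \<open>O(1)\<close> triples in \<open>near t\<close>. If a correlated pair is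
  near in neither direction, then both triples have meeting_twice sets sharing a second vertex, and there are only
  \<open>O(n\<^sup>2)\<close> such triples, of which \<open>O(n)\<close> meet a given one.\<close>

definition "near t = {(a', p', q'). p' \<in> meeting_twice (support t) \<and> a' \<in> A p' \<and> q' \<in> meeting_twice (support t \<union> A p')}"

lemma near_le:
  assumes "t \<in> triples"
  shows "finite (near t) \<and> card (near t) \<le> 2 * k * (2 * k) * K * (k * (3 * k * (3 * k) * K))"
proof (rule card_image_Sigma_le[of _ "\<lambda>(p, a, q). (a, p, q)" "meeting_twice (support t)" "\<lambda>p. SIGMA a:A p. meeting_twice (support t \<union> A p)"])
  show "near t \<subseteq> (\<lambda>(p, a, q). (a, p, q)) ` (SIGMA p:meeting_twice (support t). SIGMA a:A p. meeting_twice (support t \<union> A p))"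
    unfolding near_def by (auto simp: image_iff)
  show "finite (SIGMA a:A p. meeting_twice (support t \<union> A p)) \<and>
    card (SIGMA a:A p. meeting_twice (support t \<union> A p)) \<le> k * (3 * k * (3 * k) * K)" if "p \<in> meeting_twice (support t)" for p
  proof (rule card_Sigma_le)
    have p: "p \<in> P" using that by (simp add: meeting_twice_def)
    show "finite (A p)" "card (A p) \<le> k" using fin_A[OF p] by auto
    have "card (support t \<union> A p) \<le> 3 * k"
      using card_Un_le[of "support t" "A p"] fin_A[OF p] support_le[OF assms] by linarith
    then show "finite (meeting_twice (support t \<union> A p)) \<and> card (meeting_twice (support t \<union> A p)) \<le> 3 * k * (3 * k) * K"
      using fin_A[OF p] support_le[OF assms] by (intro meeting_twice_le) auto
  qed
qed (use meeting_twice_le[of "support t" "2 * k"] support_le[OF assms] in auto)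

definition "linked t = {t' \<in> tight_triples. support t \<inter> support t' \<noteq> {}}"

text \<open>Choose a vertex \<open>z\<close> of the support of \<open>t\<close>, a set through
  \<open>z\<close>, and its marked vertex; by tightness the other set meets the chosen one twice.
  The set through \<open>z\<close> may be either component, hence the two images and the factor
  2.\<close>

lemma linked_le:
  assumes "t \<in> triples"
  shows "finite (linked t) \<and> card (linked t) \<le> 2 * k * (2 * (n * K * (k * (k * k * K))))"
proof (rule card_UN_bounded[of _
      "\<lambda>z. (\<lambda>(p, a, q). (a, p, q)) ` (SIGMA p:star_at z. SIGMA a:A p. meeting_twice (A p)) \<union>
           (\<lambda>(p, a, q). (a, q, p)) ` (SIGMA p:star_at z. SIGMA a:A p. meeting_twice (A p))" "support t"])
  show "linked t \<subseteq> (\<Union>z\<in>support t. (\<lambda>(p, a, q). (a, p, q)) ` (SIGMA p:star_at z. SIGMA a:A p. meeting_twice (A p)) \<union>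
           (\<lambda>(p, a, q). (a, q, p)) ` (SIGMA p:star_at z. SIGMA a:A p. meeting_twice (A p)))"
  proof
    fix t' assume t': "t' \<in> linked t"
    obtain a' p' q' where eq: "t' = (a', p', q')" by (cases t')
    obtain z x where z: "z \<in> support t" "z \<in> A p' \<or> z \<in> A q'"
      and t2: "p' \<in> P" "q' \<in> P" "a' \<in> A p'" "a' \<in> A q'" "x \<noteq> a'" "x \<in> A p'" "x \<in> A q'"
      using t' unfolding linked_def tight_triples_def support_def eq by auto
    have "p' \<in> meeting_twice (A q')" "q' \<in> meeting_twice (A p')" using t2 unfolding meeting_twice_def by auto
    then show "t' \<in> (\<Union>z\<in>support t. (\<lambda>(p, a, q). (a, p, q)) ` (SIGMA p:star_at z. SIGMA a:A p. meeting_twice (A p)) \<union>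
           (\<lambda>(p, a, q). (a, q, p)) ` (SIGMA p:star_at z. SIGMA a:A p. meeting_twice (A p)))"
      using z t2 unfolding eq star_at_def by (intro UN_I[OF z(1)]) (auto simp: image_iff)
  qed
  fix z assume "z \<in> support t"
  let ?S = "SIGMA p:star_at z. SIGMA a:A p. meeting_twice (A p)"
  have S: "finite ?S \<and> card ?S \<le> n * K * (k * (k * k * K))"
  proof (rule card_Sigma_le)
    fix p assume "p \<in> star_at z"
    then have p: "p \<in> P" by (simp add: star_at_def)
    show "finite (SIGMA a:A p. meeting_twice (A p)) \<and> card (SIGMA a:A p. meeting_twice (A p)) \<le> k * (k * k * K)"
      by (rule card_Sigma_le) (use fin_A[OF p] meeting_twice_le in auto)
  qed (use star_at_le in auto)
  show "finite ((\<lambda>(p, a, q). (a, p, q)) ` ?S \<union> (\<lambda>(p, a, q). (a, q, p)) ` ?S) \<and>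
    card ((\<lambda>(p, a, q). (a, p, q)) ` ?S \<union> (\<lambda>(p, a, q). (a, q, p)) ` ?S) \<le> 2 * (n * K * (k * (k * k * K)))"
    using card_Un_le[of "(\<lambda>(p, a, q). (a, p, q)) ` ?S" "(\<lambda>(p, a, q). (a, q, p)) ` ?S"]
      card_image_le[of ?S "\<lambda>(p, a, q). (a, p, q)"] card_image_le[of ?S "\<lambda>(p, a, q). (a, q, p)"] S by auto
qed (use support_le[OF assms] in auto)

text \<open>Exponents of the monomial that the triple contributes to a product of two gradients:
  both sets lose the common vertex \<open>a\<close>.\<close>

definition covering :: "'v \<times> 'p \<times> 'p \<Rightarrow> 'v \<Rightarrow> nat" where
  "covering = (\<lambda>(a, p, q) v. of_bool (v \<in> A p - {a}) + of_bool (v \<in> A q - {a}))"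

text \<open>The pairs of triples whose monomials can be correlated: no vertex is covered exactly once,
  and the meeting_twice triples share a vertex.\<close>

definition related :: "'v \<times> 'p \<times> 'p \<Rightarrow> 'v \<times> 'p \<times> 'p \<Rightarrow> bool" where
  "related t t' \<longleftrightarrow> (\<forall>v. covering t v + covering t' v \<noteq> 1) \<and> (\<exists>v. covering t v \<noteq> 0 \<and> covering t' v \<noteq> 0)"

text \<open>The two given vertices place \<open>p'\<close> in \<open>meeting_twice\<close> of the
  support. As for \<open>q'\<close>, it has a vertex \<open>z\<close> besides \<open>a'\<close>; not
  being covered exactly once, \<open>z\<close> lies in \<open>A p\<close>, \<open>A q\<close> or
  \<open>A p'\<close>. Since also \<open>a' \<in> A p'\<close>, the set of \<open>q'\<close> meets
  the enlarged support twice.\<close>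

lemma near_if_meeting_twice:
  assumes rel: "related (a, p, q) (a', p', q')" and t': "(a', p', q') \<in> triples"
    and xy: "x \<noteq> y" "x \<in> A p' - {a'}" "y \<in> A p' - {a'}" "x \<in> support (a, p, q)" "y \<in> support (a, p, q)"
  shows "(a', p', q') \<in> near (a, p, q)"
proof -
  have "2 \<le> card (A q')" using A_ge[of q'] t' by (simp add: triples_def)
  then obtain z where z: "z \<in> A q'" "z \<noteq> a'" by (rule obtain_other)
  then have "z \<in> A p \<or> z \<in> A q \<or> z \<in> A p'"
    using rel unfolding related_def covering_def by (auto dest!: spec[of _ z])
  then have "q' \<in> meeting_twice (support (a, p, q) \<union> A p')"
    using z t' unfolding meeting_twice_def support_def triples_def by auto
  then show ?thesis using xy t' unfolding near_def meeting_twice_def triples_def by auto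
qed

lemma related_sym: "related t t' \<Longrightarrow> related t' t"
  unfolding related_def by (auto simp: add.commute)

text \<open>At least two vertices of \<open>A p'\<close> differ from \<open>a'\<close>. Were they
  all in the support, the triple would be near; so one lies outside, and it can only be covered a
  second time by \<open>q'\<close>.\<close>

lemma tight_if_not_near:
  assumes rel: "related (a, p, q) (a', p', q')" and t': "(a', p', q') \<in> triples"
    and "(a', p', q') \<notin> near (a, p, q)"
  shows "(a', p', q') \<in> tight_triples"
proof -
  have "2 \<le> card (A p' - {a'})"
    using A_ge[of p'] t' by (simp add: triples_def)
  then obtain x y where xy: "x \<in> A p' - {a'}" "y \<in> A p' - {a'}" "x \<noteq> y" by (rule obtain_two)
  have "\<exists>z. z \<in> A p' - {a'} \<and> z \<notin> support (a, p, q)"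
    using near_if_meeting_twice[OF rel t' xy(3,1,2)] assms(3) xy by blast
  then obtain z where z: "z \<in> A p' - {a'}" "z \<notin> support (a, p, q)" by blast
  then have "z \<in> A q'" using rel unfolding related_def covering_def support_def by (auto dest!: spec[of _ z])
  then show ?thesis using z t' unfolding triples_def tight_triples_def by auto
qed

text \<open>Coefficient of n^3 in the count: near pairs in both directions, then order n^2 tight
  triples times order \<open>n\<close> linked ones.\<close>

definition "rel_const = 2 * (K * K * (2 * k * (2 * k) * K * (k * (3 * k * (3 * k) * K))))
  + K * (k * (k * k * K)) * (2 * k * (2 * (K * (k * (k * k * K)))))"

lemma card_related_le:
  "card {(t, t'). t \<in> triples \<and> t' \<in> triples \<and> related t t'} \<le> rel_const * n ^ 3"
proof -
  let ?N = "SIGMA t:triples. near t" and ?L = "SIGMA t:tight_triples. linked t"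
  let ?c = "2 * k * (2 * k) * K * (k * (3 * k * (3 * k) * K))"
  let ?d = "2 * k * (2 * (n * K * (k * (k * k * K))))"
  have sub: "tight_triples \<subseteq> triples" unfolding triples_def tight_triples_def by auto
  have N: "finite ?N \<and> card ?N \<le> n * (n * K * (n * K)) * ?c"
    by (rule card_Sigma_le) (use triples_le near_le in auto)
  have L: "finite ?L \<and> card ?L \<le> n * (n * K) * (k * (k * k * K)) * ?d"
    by (rule card_Sigma_le) (use tight_triples_le linked_le sub in auto)
  have "{(t, t'). t \<in> triples \<and> t' \<in> triples \<and> related t t'} \<subseteq> ?N \<union> prod.swap ` ?N \<union> ?L"
  proof
    fix u assume "u \<in> {(t, t'). t \<in> triples \<and> t' \<in> triples \<and> related t t'}"
    then obtain a p q a' p' q' where u: "u = ((a, p, q), (a', p', q'))" and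
      *: "(a, p, q) \<in> triples" "(a', p', q') \<in> triples" "related (a, p, q) (a', p', q')"
      by auto
    show "u \<in> ?N \<union> prod.swap ` ?N \<union> ?L"
    proof (rule ccontr)
      assume nn: "u \<notin> ?N \<union> prod.swap ` ?N \<union> ?L"
      have n1: "(a', p', q') \<notin> near (a, p, q)" using nn * u by blast
      have "((a', p', q'), (a, p, q)) \<notin> ?N" using nn u by (auto simp: image_iff)
      then have n2: "(a, p, q) \<notin> near (a', p', q')" using * by blast
      have "(a', p', q') \<in> tight_triples" "(a, p, q) \<in> tight_triples"
        using tight_if_not_near[OF *(3,2) n1] tight_if_not_near[OF related_sym[OF *(3)] *(1) n2] by auto
      moreover have "support (a, p, q) \<inter> support (a', p', q') \<noteq> {}"
        using *(3) unfolding related_def covering_def support_def by (auto simp: of_bool_def split: if_splits)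
      ultimately show False using nn u unfolding linked_def by auto
    qed
  qed
  then have "card {(t, t'). t \<in> triples \<and> t' \<in> triples \<and> related t t'} \<le> card (?N \<union> prod.swap ` ?N \<union> ?L)"
    using N L by (intro card_mono) auto
  also have "\<dots> \<le> card ?N + card ?N + card ?L"
    using N card_image_le[of ?N prod.swap] card_Un_le[of "?N \<union> prod.swap ` ?N" ?L] card_Un_le[of ?N "prod.swap ` ?N"]
    by linarith
  also have "\<dots> \<le> 2 * (n * (n * K * (n * K)) * ?c) + n * (n * K) * (k * (k * k * K)) * ?d"
    using N L by linarith
  also have "\<dots> = rel_const * n ^ 3"
    unfolding rel_const_def by (simp add: algebra_simps power3_eq_cube)
  finally show ?thesis .
qed

text \<open>Indices of the monomials in the sum of all components of one gradient, which arises when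
  the other polynomial has degree 1.\<close>

definition "flags = {(a, p). p \<in> P \<and> a \<in> A p}"

lemma flags_le: "finite flags \<and> card flags \<le> n * (n * K) * k"
proof (rule card_image_Sigma_le[of _ "\<lambda>(p, a). (a, p)" P A])
  show "flags \<subseteq> (\<lambda>(p, a). (a, p)) ` Sigma P A" unfolding flags_def by (auto simp: image_iff)
qed (use P_le fin_A in auto)

text \<open>The common remainder has at least two vertices, so \<open>p'\<close> meets
  \<open>A p\<close> twice and each flag has O(1) partners.\<close>

lemma card_flags_related_le:
  "card {((a, p), (a', p')). (a, p) \<in> flags \<and> (a', p') \<in> flags \<and> A p - {a} = A p' - {a'}} \<le> K * k * (k * k * K * k) * n\<^sup>2"
proof -
  let ?S = "SIGMA t:flags. SIGMA p':meeting_twice (A (snd t)). A p'"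
  have "finite {((a, p), (a', p')). (a, p) \<in> flags \<and> (a', p') \<in> flags \<and> A p - {a} = A p' - {a'}} \<and>
    card {((a, p), (a', p')). (a, p) \<in> flags \<and> (a', p') \<in> flags \<and> A p - {a} = A p' - {a'}}
      \<le> n * (n * K) * k * (k * k * K * k)"
  proof (rule card_image_Sigma_le[of _ "\<lambda>(t, p', a'). (t, (a', p'))" flags "\<lambda>t. SIGMA p':meeting_twice (A (snd t)). A p'"])
    show "{((a, p), (a', p')). (a, p) \<in> flags \<and> (a', p') \<in> flags \<and> A p - {a} = A p' - {a'}}
        \<subseteq> (\<lambda>(t, p', a'). (t, (a', p'))) ` ?S"
    proof safe
      fix a p a' p' assume *: "(a, p) \<in> flags" "(a', p') \<in> flags" "A p - {a} = A p' - {a'}"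
      have "2 \<le> card (A p - {a})" using A_ge[of p] *(1) by (simp add: flags_def)
      then obtain x y where "x \<in> A p - {a}" "y \<in> A p - {a}" "x \<noteq> y" by (rule obtain_two)
      then have "p' \<in> meeting_twice (A p)" using * unfolding meeting_twice_def flags_def by auto
      then show "((a, p), (a', p')) \<in> (\<lambda>(t, p', a'). (t, (a', p'))) ` ?S"
        using * by (auto simp: image_iff flags_def)
    qed
    fix t assume "t \<in> flags"
    then have "snd t \<in> P" by (auto simp: flags_def)
    note t = fin_A[OF this]
    show "finite (SIGMA p':meeting_twice (A (snd t)). A p') \<and> card (SIGMA p':meeting_twice (A (snd t)). A p') \<le> k * k * K * k"
    proof (rule card_Sigma_le)
      show "finite (A p') \<and> card (A p') \<le> k" if "p' \<in> meeting_twice (A (snd t))" for p'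
        using that fin_A by (auto simp: meeting_twice_def)
    qed (use meeting_twice_le t in auto)
  qed (use flags_le in auto)
  then show ?thesis by (simp add: algebra_simps power2_eq_square)
qed

end

section \<open>Second moments of sums of monomials\<close>

definition monomial :: "'v set \<Rightarrow> ('v \<Rightarrow> nat) \<Rightarrow> ('v \<Rightarrow> real) \<Rightarrow> real" where
  "monomial V e x = (\<Prod>v\<in>V. x v ^ e v)"

definition monomial_mean :: "'v set \<Rightarrow> ('v \<Rightarrow> nat) \<Rightarrow> real" where
  "monomial_mean V e = (\<Prod>v\<in>V. std_normal_moment (e v))"

lemma monomial_add: "monomial V (\<lambda>v. e v + e' v) x = monomial V e x * monomial V e' x"
  by (simp add: monomial_def power_add prod.distrib)

lemma all_moments_monomial: "V \<subseteq> I \<Longrightarrow> all_moments (std_gaussian I) (monomial V e)"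
proof -
  assume V: "V \<subseteq> I"
  have "all_moments (std_gaussian I) (\<lambda>x. x v ^ m)" if "v \<in> V" for v m
    using that V by (induction m) (auto intro!: all_moments_mult all_moments_const prob_space_std_gaussian all_moments_coord)
  then show ?thesis unfolding monomial_def[abs_def] by (intro all_moments_prod prob_space_std_gaussian)
qed

lemma integral_monomial:
  assumes "finite I" "V \<subseteq> I"
  shows "(\<integral>x. monomial V e x \<partial>std_gaussian I) = monomial_mean V e"
proof -
  let ?e = "\<lambda>v. if v \<in> V then e v else 0"
  have "monomial V e x = (\<Prod>v\<in>I. x v ^ ?e v)" for x
    unfolding monomial_def using assms by (intro prod.mono_neutral_cong_left) auto
  moreover have "monomial_mean V e = (\<Prod>v\<in>I. std_normal_moment (?e v))"
    unfolding monomial_mean_def using assms by (intro prod.mono_neutral_cong_left) (auto simp: std_normal_moment_0)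
  ultimately show ?thesis using integral_std_gaussian_prod_power[OF assms(1), of ?e] by simp
qed

text \<open>Two exponent vectors with entries at most 2 add up to entries at most 4, where the
  moments are 1, 0, 1, 0, 3. This is the origin of the base 3 in later bounds.\<close>

lemma std_normal_moment_bounds:
  assumes "m \<le> 4"
  shows "0 \<le> std_normal_moment m" "std_normal_moment m \<le> (if m = 0 then 1 else 3)"
proof -
  have "m \<in> {0, 1, 2, 3, 4}" using assms by auto
  then show "0 \<le> std_normal_moment m" "std_normal_moment m \<le> (if m = 0 then 1 else 3)"
    by (auto simp: std_normal_moment_0 std_normal_moment_2 std_normal_moment_4 std_normal_moment_odd_eq)
qed

lemma std_normal_moment_1: "std_normal_moment 1 = 0" "std_normal_moment (Suc 0) = 0"
  by (simp_all add: std_normal_moment_odd_eq)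

lemma monomial_mean_nonneg: "(\<And>v. e v \<le> 4) \<Longrightarrow> 0 \<le> monomial_mean V e"
  unfolding monomial_mean_def by (intro prod_nonneg std_normal_moment_bounds)

lemma monomial_mean_le:
  assumes V: "finite V" and e: "\<And>v. e v \<le> 4" and s: "card {v \<in> V. e v \<noteq> 0} \<le> s"
  shows "monomial_mean V e \<le> 3 ^ s"
proof -
  have "monomial_mean V e \<le> (\<Prod>v\<in>V. if e v = 0 then 1 else 3)"
    unfolding monomial_mean_def by (intro prod_mono conjI std_normal_moment_bounds e)
  also have "\<dots> = 3 ^ card {v \<in> V. e v \<noteq> 0}"
    using V by (simp add: prod.If_cases Collect_neg_eq[symmetric] Int_def)
  also have "\<dots> \<le> 3 ^ s" using s by (intro power_increasing) auto
  finally show ?thesis .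
qed

lemma monomial_mean_eq_0:
  assumes "finite V" "v \<in> V" "e v = 1"
  shows "monomial_mean V e = 0"
  unfolding monomial_mean_def using assms by (intro prod_zero bexI[of _ v]) (simp_all add: std_normal_moment_1)

text \<open>If the exponents at \<open>v\<close> add up to 1, one of them is 1, and both sides
  vanish by oddness; if no variable is shared, the monomials are independent.\<close>

lemma monomial_mean_covariance:
  assumes V: "finite V"
    and nr: "(\<exists>v\<in>V. e v + e' v = 1) \<or> (\<forall>v\<in>V. e v = 0 \<or> e' v = (0::nat))"
  shows "monomial_mean V (\<lambda>v. e v + e' v) = monomial_mean V e * monomial_mean V e'"
  using nr
proof
  assume "\<exists>v\<in>V. e v + e' v = 1"
  then obtain v where v: "v \<in> V" "e v + e' v = 1" by blast
  then have "monomial_mean V e = 0 \<or> monomial_mean V e' = 0" using monomial_mean_eq_0[OF V v(1)] by (metis add_is_1 One_nat_def)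
  then show ?thesis using monomial_mean_eq_0[OF V v(1), of "\<lambda>v. e v + e' v"] v by auto
next
  assume "\<forall>v\<in>V. e v = 0 \<or> e' v = (0::nat)"
  then show ?thesis unfolding monomial_mean_def prod.distrib[symmetric]
    by (intro prod.cong refl) (auto simp: std_normal_moment_0)
qed

text \<open>Expanding the square leaves covariances, which vanish off the displayed set of pairs. On
  it, at most \<open>2 * s\<close> variables occur, each contributing a moment of at most 3.\<close>

lemma variance_sum_monomials_le:
  fixes e :: "'t \<Rightarrow> 'v \<Rightarrow> nat"
  assumes I: "finite I" "V \<subseteq> I" and T: "finite T"
    and e: "\<And>t v. t \<in> T \<Longrightarrow> e t v \<le> 2" and s: "\<And>t. t \<in> T \<Longrightarrow> card {v \<in> V. e t v \<noteq> 0} \<le> s"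
  shows "(\<integral>x. (\<Sum>t\<in>T. monomial V (e t) x - monomial_mean V (e t))\<^sup>2 \<partial>std_gaussian I)
    \<le> 3 ^ (2 * s) * real (card {(t, t'). t \<in> T \<and> t' \<in> T \<and>
        (\<forall>v\<in>V. e t v + e t' v \<noteq> 1) \<and> (\<exists>v\<in>V. e t v \<noteq> 0 \<and> e t' v \<noteq> 0)})"
    (is "?lhs \<le> _ * real (card ?Rel)")
proof -
  let ?\<gamma> = "std_gaussian I" and ?m = "\<lambda>t. monomial_mean V (e t)"
  let ?c = "\<lambda>t t'. monomial_mean V (\<lambda>v. e t v + e t' v) - ?m t * ?m t'"
  have V: "finite V" using I finite_subset by blast
  interpret prob_space ?\<gamma> by (rule prob_space_std_gaussian)
  have int: "integrable ?\<gamma> (monomial V e)" for e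
    by (rule all_moments_integrable[OF all_moments_monomial[OF I(2)]])
  have prod: "(monomial V (e t) x - ?m t) * (monomial V (e t') x - ?m t')
      = monomial V (\<lambda>v. e t v + e t' v) x - ?m t * monomial V (e t') x - ?m t' * monomial V (e t) x + ?m t * ?m t'" for t t' x
    by (simp add: monomial_add algebra_simps)
  have "?lhs = (\<integral>x. (\<Sum>t\<in>T. \<Sum>t'\<in>T. (monomial V (e t) x - ?m t) * (monomial V (e t') x - ?m t')) \<partial>?\<gamma>)"
    by (simp add: power2_eq_square sum_product)
  also have "\<dots> = (\<Sum>t\<in>T. \<Sum>t'\<in>T. \<integral>x. (monomial V (e t) x - ?m t) * (monomial V (e t') x - ?m t') \<partial>?\<gamma>)"
    unfolding prod by (subst Bochner_Integration.integral_sum, use int in force,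
      rule sum.cong[OF refl], subst Bochner_Integration.integral_sum) (use int in auto)
  also have "\<dots> = (\<Sum>t\<in>T. \<Sum>t'\<in>T. ?c t t')"
    unfolding prod using int by (simp add: integral_monomial[OF I] prob_space)
  also have "\<dots> = (\<Sum>(t, t')\<in>T \<times> T. ?c t t')" by (simp add: sum.cartesian_product)
  also have "\<dots> \<le> (\<Sum>(t, t')\<in>T \<times> T. if (t, t') \<in> ?Rel then 3 ^ (2 * s) else 0)"
  proof (rule sum_mono, clarify)
    fix t t' assume t: "t \<in> T" "t' \<in> T"
    show "?c t t' \<le> (if (t, t') \<in> ?Rel then 3 ^ (2 * s) else 0)"
    proof (cases "(t, t') \<in> ?Rel")
      case True
      have le4: "e t v + e t' v \<le> 4" for v using add_mono[OF e[OF t(1), of v] e[OF t(2), of v]] by simp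
      have "{v \<in> V. e t v + e t' v \<noteq> 0} = {v \<in> V. e t v \<noteq> 0} \<union> {v \<in> V. e t' v \<noteq> 0}" by auto
      then have "card {v \<in> V. e t v + e t' v \<noteq> 0} \<le> 2 * s"
        using card_Un_le[of "{v \<in> V. e t v \<noteq> 0}" "{v \<in> V. e t' v \<noteq> 0}"] s[OF t(1)] s[OF t(2)] by simp
      then have "monomial_mean V (\<lambda>v. e t v + e t' v) \<le> 3 ^ (2 * s)" by (intro monomial_mean_le V le4)
      moreover have "0 \<le> ?m t * ?m t'"
        using order_trans[OF e[OF t(1)], of 4] order_trans[OF e[OF t(2)], of 4]
        by (intro mult_nonneg_nonneg monomial_mean_nonneg) simp_all
      ultimately show ?thesis using True by simp
    next
      case False
      then have "(\<exists>v\<in>V. e t v + e t' v = 1) \<or> (\<forall>v\<in>V. e t v = 0 \<or> e t' v = 0)" using t by blast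
      then show ?thesis using False by (simp add: monomial_mean_covariance[OF V])
    qed
  qed
  also have "\<dots> = 3 ^ (2 * s) * real (card ?Rel)"
  proof -
    define Rel where "Rel = ?Rel"
    have "Rel \<subseteq> T \<times> T" unfolding Rel_def by auto
    moreover have "(\<Sum>(t, t')\<in>T \<times> T. if (t, t') \<in> Rel then 3 ^ (2 * s) else 0)
        = (\<Sum>u\<in>T \<times> T. if u \<in> Rel then 3 ^ (2 * s) else (0::real))"
      by (rule sum.cong) auto
    ultimately show ?thesis using T unfolding Rel_def[symmetric] by (simp add: sum.If_cases Int_absorb1)
  qed
  finally show ?thesis .
qed

lemma (in sparse_family) variance_triples_le:
  assumes I: "finite I" "V \<subseteq> I" and T: "T \<subseteq> triples"
  shows "(\<integral>x. (\<Sum>t\<in>T. monomial V (covering t) x - monomial_mean V (covering t))\<^sup>2 \<partial>std_gaussian I)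
    \<le> 3 ^ (4 * k) * real rel_const * real n ^ 3"
proof -
  let ?S = "{(t, t'). t \<in> T \<and> t' \<in> T \<and> (\<forall>v\<in>V. covering t v + covering t' v \<noteq> 1) \<and> (\<exists>v\<in>V. covering t v \<noteq> 0 \<and> covering t' v \<noteq> 0)}"
  let ?R = "{(t, t'). t \<in> triples \<and> t' \<in> triples \<and> related t t'}"
  have supp: "{v \<in> V. covering t v \<noteq> 0} \<subseteq> support t" for t
    unfolding covering_def support_def by (cases t) auto
  have fin: "finite ?R"
    by (rule finite_subset[of _ "triples \<times> triples"]) (use triples_le in auto)
  have out: "covering t v = 0" if "t \<in> triples" "v \<notin> V" for t v
    using that(1) that(2) unfolding triples_def covering_def by (auto dest: A_V[THEN subsetD])
  have "?S \<subseteq> ?R"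
  proof
    fix u assume u: "u \<in> ?S"
    obtain t t' where eq: "u = (t, t')" by (cases u)
    from u have t: "t \<in> T" "t' \<in> T" and ne: "\<forall>v\<in>V. covering t v + covering t' v \<noteq> 1"
      and ex: "\<exists>v\<in>V. covering t v \<noteq> 0 \<and> covering t' v \<noteq> 0"
      unfolding eq mem_Collect_eq prod.case by blast+
    have tt: "t \<in> triples" "t' \<in> triples" using t T by auto
    have "covering t v + covering t' v \<noteq> 1" for v
      using ne out[OF tt(1), of v] out[OF tt(2), of v] by (cases "v \<in> V") auto
    then show "u \<in> ?R" using tt ex unfolding eq related_def by blast
  qed
  then have "card ?S \<le> rel_const * n ^ 3"
    using card_mono[OF fin] card_related_le by (meson le_trans)
  then have "real (card ?S) \<le> real (rel_const * n ^ 3)" by (rule of_nat_mono)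
  then have S: "real (card ?S) \<le> real rel_const * real n ^ 3" by (simp only: of_nat_mult of_nat_power)
  have "(\<integral>x. (\<Sum>t\<in>T. monomial V (covering t) x - monomial_mean V (covering t))\<^sup>2 \<partial>std_gaussian I)
      \<le> 3 ^ (2 * (2 * k)) * real (card ?S)"
  proof (rule variance_sum_monomials_le[OF I])
    show "finite T" using T triples_le finite_subset by blast
    show "covering t v \<le> 2" for t v unfolding covering_def by (cases t) auto
    show "card {v \<in> V. covering t v \<noteq> 0} \<le> 2 * k" if "t \<in> T" for t
      using card_mono[OF _ supp, of t] support_le[of t] T that by auto
  qed
  also have "\<dots> \<le> 3 ^ (2 * (2 * k)) * (real rel_const * real n ^ 3)"
    using S by (intro mult_left_mono) auto
  finally show ?thesis by (simp add: mult.assoc)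
qed

text \<open>Every monomial has an exponent 1, hence mean zero, so the second moment is the variance.
  With exponents 0 and 1, having no vertex covered exactly once means that the two sets are
  equal.\<close>

lemma (in sparse_family) second_moment_flags_le:
  assumes I: "finite I" "V \<subseteq> I" and F: "F \<subseteq> flags"
  shows "(\<integral>x. (\<Sum>(a, p)\<in>F. monomial V (\<lambda>v. of_bool (v \<in> A p - {a})) x)\<^sup>2 \<partial>std_gaussian I)
    \<le> 3 ^ (2 * k) * real (K * k * (k * k * K * k)) * real n ^ 2"
proof -
  let ?e = "\<lambda>(a, p) v. of_bool (v \<in> A p - {a}) :: nat"
  let ?S = "{(t, t'). t \<in> F \<and> t' \<in> F \<and> (\<forall>v\<in>V. ?e t v + ?e t' v \<noteq> 1) \<and> (\<exists>v\<in>V. ?e t v \<noteq> 0 \<and> ?e t' v \<noteq> 0)}"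
  let ?R = "{((a, p), (a', p')). (a, p) \<in> flags \<and> (a', p') \<in> flags \<and> A p - {a} = A p' - {a'}}"
  have mean: "monomial_mean V (?e t) = 0" if tF: "t \<in> F" for t
  proof -
    obtain a p where t: "t = (a, p)" "p \<in> P" "a \<in> A p" using tF F unfolding flags_def by auto
    then have "2 \<le> card (A p)" using A_ge[of p] by simp
    then obtain y where "y \<in> A p" "y \<noteq> a" by (rule obtain_other)
    then show ?thesis using t A_V[OF t(2)] finite_V by (intro monomial_mean_eq_0[of V y]) auto
  qed
  have fin: "finite ?R"
    by (rule finite_subset[of _ "flags \<times> flags"]) (use flags_le in auto)
  have "?S \<subseteq> ?R"
  proof
    fix u assume u: "u \<in> ?S"
    obtain a p a' p' where eq: "u = ((a, p), (a', p'))" by (metis surj_pair)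
    have mem: "(a, p) \<in> flags" "(a', p') \<in> flags" using u F by (auto simp: eq)
    have "v \<in> A p - {a} \<longleftrightarrow> v \<in> A p' - {a'}" for v
    proof (cases "v \<in> V")
      case True
      then have "?e (a, p) v + ?e (a', p') v \<noteq> 1" using u by (auto simp: eq)
      then show ?thesis by (cases "v \<in> A p - {a}"; cases "v \<in> A p' - {a'}") auto
    next
      case False
      then show ?thesis using mem A_V unfolding flags_def by auto
    qed
    then show "u \<in> ?R" using mem unfolding eq by blast
  qed
  then have "card ?S \<le> K * k * (k * k * K * k) * n\<^sup>2"
    using card_mono[OF fin] card_flags_related_le by (meson le_trans)
  then have "real (card ?S) \<le> real (K * k * (k * k * K * k) * n\<^sup>2)" by (rule of_nat_mono)
  then have S: "real (card ?S) \<le> real (K * k * (k * k * K * k)) * real n ^ 2"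
    by (simp only: of_nat_mult of_nat_power)
  have "(\<integral>x. (\<Sum>t\<in>F. monomial V (?e t) x - monomial_mean V (?e t))\<^sup>2 \<partial>std_gaussian I) \<le> 3 ^ (2 * k) * real (card ?S)"
  proof (rule variance_sum_monomials_le[OF I])
    show "finite F" using F flags_le finite_subset by blast
    show "?e t v \<le> 2" for t v by (cases t) auto
    show "card {v \<in> V. ?e t v \<noteq> 0} \<le> k" if t: "t \<in> F" for t
    proof -
      obtain a p where t: "t = (a, p)" "p \<in> P" using t F unfolding flags_def by auto
      have "card {v \<in> V. ?e t v \<noteq> 0} \<le> card (A p)" using fin_A[OF t(2)] t(1) by (intro card_mono) auto
      then show ?thesis using fin_A[OF t(2)] by simp
    qed
  qed
  also have "\<dots> \<le> 3 ^ (2 * k) * (real (K * k * (k * k * K * k)) * real n ^ 2)"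
    using S by (intro mult_left_mono) auto
  finally have "(\<integral>x. (\<Sum>t\<in>F. monomial V (?e t) x - monomial_mean V (?e t))\<^sup>2 \<partial>std_gaussian I)
    \<le> 3 ^ (2 * k) * real (K * k * (k * k * K * k)) * real n ^ 2" by simp
  moreover have "(\<Sum>t\<in>F. monomial V (?e t) x - monomial_mean V (?e t)) = (\<Sum>(a, p)\<in>F. monomial V (\<lambda>v. of_bool (v \<in> A p - {a})) x)" for x
    by (rule sum.cong) (auto dest: mean)
  ultimately show ?thesis by simp
qed

text \<open>2 |f| \<le> r f^2 + 1/r. With \<open>r\<close> the square root of \<open>n\<close> and a
  second moment O(1/n), both terms are O(n^(-1/2)), the rate that Cauchy-Schwarz would give.\<close>

lemma (in prob_space) expectation_abs_le:
  assumes "all_moments M f" "r > 0"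
  shows "expectation (\<lambda>x. \<bar>f x\<bar>) \<le> (r * expectation (\<lambda>x. (f x)\<^sup>2) + 1 / r) / 2"
proof -
  have i2: "integrable M (\<lambda>x. (f x)\<^sup>2)" using assms(1) unfolding all_moments_def by (metis (no_types, lifting) Bochner_Integration.integrable_cong power2_abs)
  have "\<bar>f x\<bar> \<le> (r * (f x)\<^sup>2 + 1 / r) / 2" for x
  proof -
    have "0 \<le> (r * \<bar>f x\<bar> - 1)\<^sup>2" by simp
    then have "2 * r * \<bar>f x\<bar> \<le> r\<^sup>2 * (f x)\<^sup>2 + 1" by (simp add: power2_diff power_mult_distrib)
    then show ?thesis using assms(2) by (simp add: field_simps power2_eq_square)
  qed
  then have "expectation (\<lambda>x. \<bar>f x\<bar>) \<le> expectation (\<lambda>x. (r * (f x)\<^sup>2 + 1 / r) / 2)"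
    using i2 assms(1) by (intro integral_mono) (auto intro: all_moments_integrable)
  also have "\<dots> = (r * expectation (\<lambda>x. (f x)\<^sup>2) + 1 / r) / 2"
    using i2 by (simp add: prob_space)
  finally show ?thesis .
qed

section \<open>Homogeneous multilinear polynomials\<close>

text \<open>The sum runs over indices, not sets, so a set that arises from several progressions
  counts with multiplicity.\<close>

definition hpoly :: "real \<Rightarrow> 'p set \<Rightarrow> ('p \<Rightarrow> 'v set) \<Rightarrow> ('v \<Rightarrow> real) \<Rightarrow> real" where
  "hpoly c P A x = c * (\<Sum>p\<in>P. \<Prod>v\<in>A p. x v)"

definition hgrad :: "real \<Rightarrow> 'p set \<Rightarrow> ('p \<Rightarrow> 'v set) \<Rightarrow> 'v \<Rightarrow> ('v \<Rightarrow> real) \<Rightarrow> real" where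
  "hgrad c P A a x = c * (\<Sum>p | p \<in> P \<and> a \<in> A p. \<Prod>v\<in>A p - {a}. x v)"

lemma hpoly_upd:
  assumes "finite P" "\<And>p. p \<in> P \<Longrightarrow> finite (A p)"
  shows "hpoly c P A (x(a := t)) = hpoly c P A x + (t - x a) * hgrad c P A a x"
proof -
  have *: "(\<Prod>v\<in>A p. (x(a := t)) v) = (\<Prod>v\<in>A p. x v) + (if a \<in> A p then (t - x a) * (\<Prod>v\<in>A p - {a}. x v) else 0)"
    if p: "p \<in> P" for p
  proof (cases "a \<in> A p")
    case True
    have "(\<Prod>v\<in>A p - {a}. (x(a := t)) v) = (\<Prod>v\<in>A p - {a}. x v)" by (rule prod.cong) auto
    then show ?thesis using True prod.remove[OF assms(2)[OF p] True, of "x(a := t)"] prod.remove[OF assms(2)[OF p] True, of x]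
      by (simp add: algebra_simps)
  next
    case False
    then show ?thesis by (auto intro!: prod.cong)
  qed
  have "(\<Sum>p\<in>P. if a \<in> A p then (t - x a) * (\<Prod>v\<in>A p - {a}. x v) else 0)
      = (t - x a) * (\<Sum>p | p \<in> P \<and> a \<in> A p. \<Prod>v\<in>A p - {a}. x v)"
    using assms(1) by (simp add: sum.inter_filter[symmetric] sum_distrib_left)
  moreover have "(\<Sum>p\<in>P. \<Prod>v\<in>A p. (x(a := t)) v)
      = (\<Sum>p\<in>P. \<Prod>v\<in>A p. x v) + (\<Sum>p\<in>P. if a \<in> A p then (t - x a) * (\<Prod>v\<in>A p - {a}. x v) else 0)"
    unfolding sum.distrib[symmetric] by (intro sum.cong refl *)
  ultimately show ?thesis
    unfolding hpoly_def hgrad_def by (simp only: distrib_left mult.left_commute)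
qed

lemma hpoly_cong: "(\<And>p v. p \<in> P \<Longrightarrow> v \<in> A p \<Longrightarrow> x v = y v) \<Longrightarrow> hpoly c P A x = hpoly c P A y"
  unfolding hpoly_def by (auto intro!: sum.cong prod.cong arg_cong[of _ _ "(*) c"])

lemma hgrad_upd: "hgrad c P A a (x(a := t)) = hgrad c P A a x"
  unfolding hgrad_def by (auto intro!: sum.cong prod.cong)

lemma hpoly_euler:
  assumes "finite P" "finite V" "\<And>p. p \<in> P \<Longrightarrow> A p \<subseteq> V" "\<And>p. p \<in> P \<Longrightarrow> card (A p) = l"
  shows "(\<Sum>a\<in>V. x a * hgrad c P A a x) = real l * hpoly c P A x"
proof -
  have "(\<Sum>a\<in>V. x a * hgrad c P A a x)
      = (\<Sum>a\<in>V. c * (\<Sum>p\<in>P. if a \<in> A p then x a * (\<Prod>v\<in>A p - {a}. x v) else 0))"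
    unfolding hgrad_def using assms(1)
    by (simp add: sum.inter_filter[symmetric] sum_distrib_left algebra_simps)
  also have "\<dots> = c * (\<Sum>p\<in>P. \<Sum>a\<in>V. if a \<in> A p then x a * (\<Prod>v\<in>A p - {a}. x v) else 0)"
    by (subst sum.swap) (simp add: sum_distrib_left)
  also have "(\<Sum>p\<in>P. \<Sum>a\<in>V. if a \<in> A p then x a * (\<Prod>v\<in>A p - {a}. x v) else 0)
      = (\<Sum>p\<in>P. real l * (\<Prod>v\<in>A p. x v))"
  proof (rule sum.cong[OF refl])
    fix p assume p: "p \<in> P"
    have "(\<Sum>a\<in>V. if a \<in> A p then x a * (\<Prod>v\<in>A p - {a}. x v) else 0)
        = (\<Sum>a\<in>V \<inter> A p. x a * (\<Prod>v\<in>A p - {a}. x v))"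
      using assms(2) by (simp add: sum.inter_restrict)
    also have "\<dots> = (\<Sum>a\<in>A p. \<Prod>v\<in>A p. x v)"
      using assms(3)[OF p] finite_subset[OF assms(3)[OF p] assms(2)]
      by (intro sum.cong) (auto simp: prod.remove)
    finally show "(\<Sum>a\<in>V. if a \<in> A p then x a * (\<Prod>v\<in>A p - {a}. x v) else 0) = real l * (\<Prod>v\<in>A p. x v)"
      using assms(4)[OF p] by simp
  qed
  finally show ?thesis by (simp add: hpoly_def sum_distrib_left algebra_simps)
qed

lemma prod_eq_monomial:
  assumes "finite V" "B \<subseteq> V"
  shows "(\<Prod>v\<in>B. x v) = monomial V (\<lambda>v. of_bool (v \<in> B)) x"
proof -
  have "(\<Prod>v\<in>B. x v) = (\<Prod>v\<in>B. x v ^ of_bool (v \<in> B))" by (rule prod.cong) auto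
  also have "\<dots> = monomial V (\<lambda>v. of_bool (v \<in> B)) x"
    unfolding monomial_def using assms by (intro prod.mono_neutral_left) auto
  finally show ?thesis .
qed

lemma all_moments_prod_coord:
  "B \<subseteq> I \<Longrightarrow> all_moments (std_gaussian I) (\<lambda>x. \<Prod>v\<in>B. x v)"
  by (intro all_moments_prod prob_space_std_gaussian all_moments_coord) auto

lemma all_moments_hpoly:
  "(\<And>p. p \<in> P \<Longrightarrow> A p \<subseteq> I) \<Longrightarrow> all_moments (std_gaussian I) (hpoly c P A)"
  unfolding hpoly_def[abs_def]
  by (intro all_moments_mult all_moments_sum all_moments_const prob_space_std_gaussian all_moments_prod_coord)

lemma all_moments_hgrad:
  "(\<And>p. p \<in> P \<Longrightarrow> A p \<subseteq> I) \<Longrightarrow> all_moments (std_gaussian I) (hgrad c P A a)"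
  unfolding hgrad_def[abs_def]
  by (intro all_moments_mult all_moments_sum all_moments_const prob_space_std_gaussian all_moments_prod_coord) auto

text \<open>A vertex in exactly one of the sets has exponent 1 and kills the mean; for equal sets
  all exponents are 0 or 2, with moment 1.\<close>

lemma monomial_mean_pair:
  assumes V: "finite V" and B: "B \<subseteq> V" "B' \<subseteq> V"
  shows "monomial_mean V (\<lambda>v. of_bool (v \<in> B) + of_bool (v \<in> B')) = of_bool (B = B')"
proof (cases "B = B'")
  case True
  then show ?thesis unfolding monomial_mean_def using std_normal_moment_0 std_normal_moment_2 by (auto intro!: prod.neutral simp: numeral_2_eq_2)
next
  case False
  then obtain v where "v \<in> B \<and> v \<notin> B' \<or> v \<notin> B \<and> v \<in> B'" by blast
  then show ?thesis using False B V by (subst monomial_mean_eq_0[of V v]) auto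
qed

lemma hpoly_second_moment:
  fixes A :: "'p \<Rightarrow> 'v set"
  assumes I: "finite I" and P: "finite P" "\<And>p. p \<in> P \<Longrightarrow> A p \<subseteq> I"
  shows "(\<integral>x. (hpoly c P A x)\<^sup>2 \<partial>std_gaussian I) = c\<^sup>2 * real (card {(p, q). p \<in> P \<and> q \<in> P \<and> A p = A q})"
proof -
  let ?e = "\<lambda>p v. of_bool (v \<in> A p) :: nat"
  have int: "integrable (std_gaussian I) (monomial I e)" for e
    by (intro all_moments_integrable all_moments_monomial) auto
  have "(\<Sum>p\<in>P. \<Prod>v\<in>A p. x v) = (\<Sum>p\<in>P. monomial I (?e p) x)" for x :: "'v \<Rightarrow> real"
    by (rule sum.cong[OF refl]) (use P(2) I in \<open>auto simp: prod_eq_monomial\<close>)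
  then have "(hpoly c P A x)\<^sup>2 = c\<^sup>2 * (\<Sum>p\<in>P. \<Sum>q\<in>P. monomial I (\<lambda>v. ?e p v + ?e q v) x)" for x
    by (simp add: hpoly_def power_mult_distrib monomial_add sum_product power2_eq_square[of "sum _ _"])
  then have "(\<integral>x. (hpoly c P A x)\<^sup>2 \<partial>std_gaussian I) = c\<^sup>2 * (\<Sum>p\<in>P. \<Sum>q\<in>P. monomial_mean I (\<lambda>v. ?e p v + ?e q v))"
    using int by (simp add: integral_monomial[OF I])
  also have "(\<Sum>p\<in>P. \<Sum>q\<in>P. monomial_mean I (\<lambda>v. ?e p v + ?e q v)) = (\<Sum>p\<in>P. \<Sum>q\<in>P. of_bool (A p = A q))"
    using P(2) by (intro sum.cong refl monomial_mean_pair I) auto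
  also have "\<dots> = (\<Sum>u\<in>P \<times> P. of_bool (A (fst u) = A (snd u)))"
    by (simp add: sum.cartesian_product case_prod_beta)
  also have "\<dots> = real (card {u \<in> P \<times> P. A (fst u) = A (snd u)})"
    using P(1) by (simp add: of_bool_def sum.inter_filter[symmetric])
  also have "{u \<in> P \<times> P. A (fst u) = A (snd u)} = {(p, q). p \<in> P \<and> q \<in> P \<and> A p = A q}" by auto
  finally show ?thesis .
qed

lemma hpoly_mean:
  assumes I: "finite I" and P: "\<And>p. p \<in> P \<Longrightarrow> A p \<subseteq> I" "\<And>p. p \<in> P \<Longrightarrow> A p \<noteq> {}"
  shows "(\<integral>x. hpoly c P A x \<partial>std_gaussian I) = 0"
proof -
  have "(\<integral>x. (\<Prod>v\<in>A p. x v) \<partial>std_gaussian I) = 0" if p: "p \<in> P" for p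
  proof -
    obtain v where "v \<in> A p" using P(2)[OF p] by blast
    then show ?thesis using P(1)[OF p] I
      by (simp add: prod_eq_monomial integral_monomial, intro monomial_mean_eq_0[of I v]) auto
  qed
  moreover have "integrable (std_gaussian I) (\<lambda>x. \<Prod>v\<in>A p. x v)" if "p \<in> P" for p
    using P(1)[OF that] by (intro all_moments_integrable all_moments_prod_coord)
  ultimately show ?thesis unfolding hpoly_def by (simp add: Bochner_Integration.integral_sum)
qed

lemma sum_Sigma:
  assumes "finite A" "\<And>a. a \<in> A \<Longrightarrow> finite (B a)"
  shows "(\<Sum>t\<in>Sigma A B. f t) = (\<Sum>a\<in>A. \<Sum>b\<in>B a. f (a, b))"
  using assms by (simp add: sum.Sigma case_prod_beta)

section \<open>Means and variances of products of gradients\<close>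

context sparse_family
begin

definition "triples_between P1 P2 = (SIGMA a:V. {p \<in> P1. a \<in> A p} \<times> {q \<in> P2. a \<in> A q})"

lemma triples_between_subset: "P1 \<subseteq> P \<Longrightarrow> P2 \<subseteq> P \<Longrightarrow> triples_between P1 P2 \<subseteq> triples"
  unfolding triples_between_def triples_def by auto

lemma sum_hgrad_product:
  assumes "P1 \<subseteq> P" "P2 \<subseteq> P"
  shows "(\<Sum>a\<in>V. hgrad c1 P1 A a x * hgrad c2 P2 A a x) = c1 * c2 * (\<Sum>t\<in>triples_between P1 P2. monomial V (covering t) x)"
proof -
  have fin: "finite P1" "finite P2" using assms finite_P finite_subset by auto
  have m: "monomial V (covering (a, p, q)) x = (\<Prod>v\<in>A p - {a}. x v) * (\<Prod>v\<in>A q - {a}. x v)"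
    if "p \<in> P" "q \<in> P" for a p q
  proof -
    have "A p - {a} \<subseteq> V" "A q - {a} \<subseteq> V" using A_V that by auto
    then show ?thesis using finite_V by (simp add: covering_def monomial_add prod_eq_monomial)
  qed
  have "(\<Sum>t\<in>triples_between P1 P2. monomial V (covering t) x)
      = (\<Sum>a\<in>V. \<Sum>p | p \<in> P1 \<and> a \<in> A p. \<Sum>q | q \<in> P2 \<and> a \<in> A q. monomial V (covering (a, p, q)) x)"
    unfolding triples_between_def using finite_V fin
    by (simp add: sum_Sigma)
  also have "\<dots> = (\<Sum>a\<in>V. (\<Sum>p | p \<in> P1 \<and> a \<in> A p. \<Prod>v\<in>A p - {a}. x v) * (\<Sum>q | q \<in> P2 \<and> a \<in> A q. \<Prod>v\<in>A q - {a}. x v))"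
    unfolding sum_product using assms by (intro sum.cong refl m) auto
  finally show ?thesis by (simp add: hgrad_def sum_distrib_left algebra_simps)
qed

lemma monomial_mean_covering:
  assumes "t \<in> triples" "t = (a, p, q)"
  shows "monomial_mean V (covering t) = of_bool (A p = A q)"
proof -
  have t: "p \<in> P" "q \<in> P" "a \<in> A p" "a \<in> A q" using assms unfolding triples_def by auto
  then have "A p - {a} = A q - {a} \<longleftrightarrow> A p = A q" by blast
  moreover have "covering t = (\<lambda>v. of_bool (v \<in> A p - {a}) + of_bool (v \<in> A q - {a}))"
    by (simp add: covering_def assms(2))
  moreover have "A p - {a} \<subseteq> V" "A q - {a} \<subseteq> V" using A_V t by auto
  ultimately show ?thesis using monomial_mean_pair[OF finite_V, of "A p - {a}" "A q - {a}"] by (simp only:)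
qed

lemma sum_monomial_mean_distinct:
  assumes "P1 \<subseteq> P" "P2 \<subseteq> P" "\<And>p q. p \<in> P1 \<Longrightarrow> q \<in> P2 \<Longrightarrow> A p \<noteq> A q"
  shows "(\<Sum>t\<in>triples_between P1 P2. monomial_mean V (covering t)) = 0"
proof (rule sum.neutral, rule ballI)
  fix t assume t: "t \<in> triples_between P1 P2"
  then have "t \<in> triples" using triples_between_subset[OF assms(1,2)] by blast
  moreover obtain a p q where "t = (a, p, q)" "p \<in> P1" "q \<in> P2" using t unfolding triples_between_def by auto
  ultimately show "monomial_mean V (covering t) = 0" using monomial_mean_covering[of t a p q] assms(3) by simp
qed

text \<open>A coinciding pair is counted once for each of its \<open>l\<close> common vertices; this
  factor later cancels the division by the degree.\<close>

lemma sum_monomial_mean_same: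
  assumes "P1 \<subseteq> P" "\<And>p. p \<in> P1 \<Longrightarrow> card (A p) = l"
  shows "(\<Sum>t\<in>triples_between P1 P1. monomial_mean V (covering t)) = real l * real (card {(p, q). p \<in> P1 \<and> q \<in> P1 \<and> A p = A q})"
proof -
  have fin: "finite P1" using assms finite_P finite_subset by auto
  let ?S = "{(p, q). p \<in> P1 \<and> q \<in> P1 \<and> A p = A q}"
  have finS: "finite ?S" by (rule finite_subset[of _ "P1 \<times> P1"]) (use fin in auto)
  have finT: "finite (triples_between P1 P1)" unfolding triples_between_def using finite_V fin by auto
  have "(\<Sum>t\<in>triples_between P1 P1. monomial_mean V (covering t)) = (\<Sum>t\<in>triples_between P1 P1. of_bool (A (fst (snd t)) = A (snd (snd t))))"
  proof (rule sum.cong[OF refl])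
    fix t assume t: "t \<in> triples_between P1 P1"
    then have "t \<in> triples" using triples_between_subset[OF assms(1) assms(1)] by blast
    then show "monomial_mean V (covering t) = of_bool (A (fst (snd t)) = A (snd (snd t)))"
      using monomial_mean_covering[of t "fst t" "fst (snd t)" "snd (snd t)"] by simp
  qed
  also have "\<dots> = real (card {t \<in> triples_between P1 P1. A (fst (snd t)) = A (snd (snd t))})"
    using finT by (simp add: of_bool_def sum.inter_filter[symmetric])
  also have "{t \<in> triples_between P1 P1. A (fst (snd t)) = A (snd (snd t))} = prod.swap ` (SIGMA u:?S. A (fst u))"
    using A_V assms(1) unfolding triples_between_def by (force simp: image_iff)
  also have "card \<dots> = card (SIGMA u:?S. A (fst u))" by (rule card_image) auto
  also have "\<dots> = (\<Sum>u\<in>?S. card (A (fst u)))"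
    using finS finite_A assms(1) by (intro card_SigmaI) auto
  also have "\<dots> = (\<Sum>u\<in>?S. l)" using assms(2) by (intro sum.cong) auto
  finally show ?thesis by simp
qed

text \<open>\<open>\<delta>\<close> is the mean of the normalised gradient product, passed as an
  equation so that the Kronecker symbol can be put in its place.\<close>

lemma variance_gradient_product_le:
  assumes I: "finite I" "V \<subseteq> I" and P12: "P1 \<subseteq> P" "P2 \<subseteq> P"
    and \<delta>: "\<delta> = c1 * c2 / L * (\<Sum>t\<in>triples_between P1 P2. monomial_mean V (covering t))"
  shows "(\<integral>x. ((\<Sum>a\<in>V. hgrad c1 P1 A a x * hgrad c2 P2 A a x) / L - \<delta>)\<^sup>2 \<partial>std_gaussian I)
    \<le> (c1 * c2 / L)\<^sup>2 * (3 ^ (4 * k) * real rel_const * real n ^ 3)"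
proof -
  have "((\<Sum>a\<in>V. hgrad c1 P1 A a x * hgrad c2 P2 A a x) / L - \<delta>)\<^sup>2
      = (c1 * c2 / L)\<^sup>2 * (\<Sum>t\<in>triples_between P1 P2. monomial V (covering t) x - monomial_mean V (covering t))\<^sup>2" for x
    unfolding \<delta> sum_hgrad_product[OF P12] sum_subtractf
    by (simp add: power_mult_distrib[symmetric] algebra_simps diff_divide_distrib)
  then have "(\<integral>x. ((\<Sum>a\<in>V. hgrad c1 P1 A a x * hgrad c2 P2 A a x) / L - \<delta>)\<^sup>2 \<partial>std_gaussian I)
      = (c1 * c2 / L)\<^sup>2 * (\<integral>x. (\<Sum>t\<in>triples_between P1 P2. monomial V (covering t) x - monomial_mean V (covering t))\<^sup>2 \<partial>std_gaussian I)"
    by simp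
  also have "\<dots> \<le> (c1 * c2 / L)\<^sup>2 * (3 ^ (4 * k) * real rel_const * real n ^ 3)"
    by (intro mult_left_mono variance_triples_le[OF I triples_between_subset[OF P12]]) auto
  finally show ?thesis .
qed

lemma second_moment_gradient_sum_le:
  assumes I: "finite I" "V \<subseteq> I" and P1: "P1 \<subseteq> P"
  shows "(\<integral>x. (b * (\<Sum>a\<in>V. hgrad c P1 A a x))\<^sup>2 \<partial>std_gaussian I)
    \<le> (b * c)\<^sup>2 * (3 ^ (2 * k) * real (K * k * (k * k * K * k)) * real n ^ 2)"
proof -
  let ?F = "SIGMA a:V. {p \<in> P1. a \<in> A p}"
  have fin: "finite P1" using P1 finite_P finite_subset by auto
  have F: "?F \<subseteq> flags" using P1 unfolding flags_def by auto
  have "(\<Sum>a\<in>V. hgrad c P1 A a x) = c * (\<Sum>(a, p)\<in>?F. monomial V (\<lambda>v. of_bool (v \<in> A p - {a})) x)" for x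
  proof -
    have "(\<Sum>(a, p)\<in>?F. monomial V (\<lambda>v. of_bool (v \<in> A p - {a})) x)
        = (\<Sum>a\<in>V. \<Sum>p | p \<in> P1 \<and> a \<in> A p. monomial V (\<lambda>v. of_bool (v \<in> A p - {a})) x)"
      using finite_V fin by (simp add: sum_Sigma)
    also have "\<dots> = (\<Sum>a\<in>V. \<Sum>p | p \<in> P1 \<and> a \<in> A p. \<Prod>v\<in>A p - {a}. x v)"
    proof (intro sum.cong refl)
      fix a p assume "p \<in> {p. p \<in> P1 \<and> a \<in> A p}"
      then have "A p - {a} \<subseteq> V" using A_V P1 by blast
      then show "monomial V (\<lambda>v. of_bool (v \<in> A p - {a})) x = (\<Prod>v\<in>A p - {a}. x v)"
        by (simp add: prod_eq_monomial[OF finite_V])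
    qed
    finally show ?thesis by (simp add: hgrad_def sum_distrib_left)
  qed
  then have "(b * (\<Sum>a\<in>V. hgrad c P1 A a x))\<^sup>2
      = (b * c)\<^sup>2 * (\<Sum>(a, p)\<in>?F. monomial V (\<lambda>v. of_bool (v \<in> A p - {a})) x)\<^sup>2" for x
    by (simp add: power_mult_distrib)
  then have "(\<integral>x. (b * (\<Sum>a\<in>V. hgrad c P1 A a x))\<^sup>2 \<partial>std_gaussian I)
      = (b * c)\<^sup>2 * (\<integral>x. (\<Sum>(a, p)\<in>?F. monomial V (\<lambda>v. of_bool (v \<in> A p - {a})) x)\<^sup>2 \<partial>std_gaussian I)"
    by simp
  also have "\<dots> \<le> (b * c)\<^sup>2 * (3 ^ (2 * k) * real (K * k * (k * k * K * k)) * real n ^ 2)"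
    by (intro mult_left_mono second_moment_flags_le[OF I F]) auto
  finally show ?thesis .
qed

end

section \<open>Arithmetic progressions modulo n\<close>

definition ap_set :: "nat \<Rightarrow> nat \<times> nat \<times> nat set \<Rightarrow> nat set" where
  "ap_set n = (\<lambda>(a, d, S). (\<lambda>i. (a + i * d) mod n) ` S)"

definition ap_index :: "nat \<Rightarrow> nat \<Rightarrow> (nat \<times> nat \<times> nat set) set" where
  "ap_index k n = {..<n} \<times> {1..n div 2} \<times> {S. S \<subseteq> {0..<k} \<and> 3 \<le> card S}"

text \<open>For \<open>l = 1\<close> the sum over \<open>d\<close> and \<open>S\<close> is a multiple of \<open>\<Sum>a<n. y a\<close>, so single points suffice there.\<close>

definition ap_family :: "nat \<Rightarrow> nat \<Rightarrow> nat \<Rightarrow> (nat \<times> nat \<times> nat set) set" where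
  "ap_family k n l = (if l = 1 then {..<n} \<times> {1} \<times> {{0}}
     else {..<n} \<times> {1..n div 2} \<times> {S. S \<subseteq> {0..<k} \<and> card S = l})"

text \<open>For \<open>l = 1\<close> the multiplicity of the sum over \<open>d\<close> and
  \<open>S\<close> cancels against \<open>kAP_sigma\<close>, leaving the normalisation of a sum of
  \<open>n\<close> variables.\<close>

definition ap_coeff :: "nat \<Rightarrow> nat \<Rightarrow> nat \<Rightarrow> real" where
  "ap_coeff k n l = (if l = 1 then 1 / sqrt (real n) else 1 / kAP_sigma k n l)"

locale ap_modulus =
  fixes k n :: nat
  assumes k: "k \<ge> 3" and n1: "n > 1" and gcd1: "gcd n (fact (k - 1)) = 1"
begin

text \<open>The absolute difference lies between 1 and \<open>k - 1\<close>, so it divides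
  \<open>fact (k - 1)\<close>.\<close>

lemma coprime_diff:
  assumes "i < k" "j < k" "i \<noteq> j"
  shows "coprime (int n) (int i - int j)"
proof -
  define m where "m = nat \<bar>int i - int j\<bar>"
  have "1 \<le> m" "m \<le> k - 1" using assms unfolding m_def by auto
  then have "m dvd fact (k - 1)" by (rule dvd_fact)
  moreover have "coprime n (fact (k - 1))" using gcd1 by (simp add: coprime_iff_gcd_eq_1)
  ultimately have "coprime n m" by (meson coprime_divisors dvd_refl)
  then have "coprime (int n) (int m)" by simp
  moreover have "int m = \<bar>int i - int j\<bar>" unfolding m_def by simp
  ultimately show ?thesis by simp
qed

lemma odd_n: "odd n"
proof
  assume "even n"
  have "(2::nat) dvd fact (k - 1)" using k by (intro dvd_fact) auto
  with \<open>even n\<close> have "2 dvd gcd n (fact (k - 1))" by (rule gcd_greatest)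
  then have "2 dvd (1::nat)" by (simp only: gcd1)
  then show False by simp
qed

lemma half_ge: "n \<le> 3 * (n div 2)" and half_pos: "n div 2 \<ge> 1"
  using odd_n n1 by presburger+

lemma dvd_step:
  assumes "i < k" "j < k" "i \<noteq> j" "int n dvd (int i - int j) * e" "\<bar>e\<bar> < int n"
  shows "e = 0"
proof -
  have "int n dvd e" using coprime_dvd_mult_right_iff[OF coprime_diff[OF assms(1-3)]] assms(4) by blast
  then show ?thesis using assms(5) zdvd_imp_le[of "int n" "\<bar>e\<bar>"] by (cases "e = 0") auto
qed

lemma mod_eq_imp_dvd: "x mod n = y mod n \<Longrightarrow> int n dvd int x - int y"
  by (metis mod_eq_dvd_iff zmod_int)

lemma ap_inj:
  assumes d: "d \<in> {1..n div 2}"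
  shows "inj_on (\<lambda>i. (a + i * d) mod n) {0..<k}"
proof (rule inj_onI, rule ccontr)
  fix i j assume ij: "i \<in> {0..<k}" "j \<in> {0..<k}" "(a + i * d) mod n = (a + j * d) mod n" "i \<noteq> j"
  have "int n dvd (int i - int j) * int d"
    using mod_eq_imp_dvd[OF ij(3)] by (simp add: algebra_simps)
  then have "int d = 0" using ij d n1 by (intro dvd_step[of i j]) auto
  then show False using d by simp
qed

text \<open>Subtracting the congruences gives (i - j)(d - d') = 0 modulo \<open>n\<close>. The first
  factor is a unit and the second is smaller than \<open>n\<close> in absolute value, so
  \<open>d = d'\<close>, and then \<open>a = a'\<close>.\<close>

lemma ap_unique:
  assumes ij: "i < k" "j < k" "i \<noteq> j" and d: "d \<in> {1..n div 2}" "d' \<in> {1..n div 2}" and a: "a < n" "a' < n"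
    and eq: "(a + i * d) mod n = (a' + i * d') mod n" "(a + j * d) mod n = (a' + j * d') mod n"
  shows "a = a' \<and> d = d'"
proof -
  have "int n dvd (int (a + i * d) - int (a' + i * d')) - (int (a + j * d) - int (a' + j * d'))"
    by (intro dvd_diff mod_eq_imp_dvd eq)
  then have "int n dvd (int i - int j) * (int d - int d')" by (simp add: algebra_simps)
  then have "int d - int d' = 0" using d n1 by (intro dvd_step[OF ij]) auto
  then have d': "d = d'" by simp
  have "int n dvd int a - int a'" using mod_eq_imp_dvd[OF eq(1)] by (simp add: d')
  then have "int a mod int n = int a' mod int n" by (simp add: mod_eq_dvd_iff)
  then show ?thesis using a d' by simp
qed

lemma finite_ap_index: "finite (ap_index k n)"
  unfolding ap_index_def by (intro finite_cartesian_product finite_subset[of "{S. S \<subseteq> {0..<k} \<and> 3 \<le> card S}" "Pow {0..<k}"]) auto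

lemma ap_set_subset: "ap_set n p \<subseteq> {..<n}"
  unfolding ap_set_def using n1 by (auto split: prod.splits)

lemma card_ap_set:
  assumes "d \<in> {1..n div 2}" "S \<subseteq> {0..<k}"
  shows "card (ap_set n (a, d, S)) = card S"
  using card_image[OF inj_on_subset[OF ap_inj[OF assms(1)] assms(2)], of a] by (simp add: ap_set_def)

text \<open>The bound counts the positions \<open>i\<close>, \<open>j\<close> of \<open>x\<close>,
  \<open>y\<close> and the set \<open>S\<close>; by \<open>ap_unique\<close> these leave at most one
  progression.\<close>

lemma ap_codegree:
  assumes "x \<noteq> y"
  shows "card {p \<in> ap_index k n. x \<in> ap_set n p \<and> y \<in> ap_set n p} \<le> k * k * 2 ^ k"
proof -
  let ?B = "\<lambda>(i, j, S). {(a, d, S') | a d S'. S' = S \<and> i \<noteq> j \<and> a < n \<and> d \<in> {1..n div 2} \<and> (a + i * d) mod n = x \<and> (a + j * d) mod n = y}"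
  let ?A = "{..<k} \<times> {..<k} \<times> Pow {0..<k}"
  have "finite {p \<in> ap_index k n. x \<in> ap_set n p \<and> y \<in> ap_set n p} \<and>
    card {p \<in> ap_index k n. x \<in> ap_set n p \<and> y \<in> ap_set n p} \<le> k * k * 2 ^ k * 1"
  proof (rule card_UN_bounded[of _ ?B ?A])
    show "{p \<in> ap_index k n. x \<in> ap_set n p \<and> y \<in> ap_set n p} \<subseteq> (\<Union>u\<in>?A. ?B u)"
    proof
      fix p assume p: "p \<in> {p \<in> ap_index k n. x \<in> ap_set n p \<and> y \<in> ap_set n p}"
      obtain a d S where eq: "p = (a, d, S)" by (cases p)
      have S: "S \<subseteq> {0..<k}" "a < n" "d \<in> {1..n div 2}" using p unfolding eq ap_index_def by auto
      obtain i j where "i \<in> S" "j \<in> S" "(a + i * d) mod n = x" "(a + j * d) mod n = y"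
        using p unfolding eq ap_set_def by auto
      then have "(i, j, S) \<in> ?A" "p \<in> ?B (i, j, S)" using S assms unfolding eq by auto
      then show "p \<in> (\<Union>u\<in>?A. ?B u)" by (rule UN_I)
    qed
    show "card ?A \<le> k * k * 2 ^ k" by (simp add: card_cartesian_product card_Pow)
    fix u assume "u \<in> ?A"
    then obtain i j S where u: "u = (i, j, S)" "i < k" "j < k" by auto
    have sub: "\<exists>p. ?B u \<subseteq> {p}"
    proof (cases "?B u = {}")
      case False
      then obtain a d where ad: "i \<noteq> j" "a < n" "d \<in> {1..n div 2}" "(a + i * d) mod n = x" "(a + j * d) mod n = y"
        unfolding u by auto
      have "?B u \<subseteq> {(a, d, S)}"
      proof
        fix q assume "q \<in> ?B u"
        then obtain a' d' where q: "q = (a', d', S)" "a' < n" "d' \<in> {1..n div 2}" "(a' + i * d') mod n = x" "(a' + j * d') mod n = y"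
          unfolding u by auto
        have "a' = a \<and> d' = d"
          by (rule ap_unique[OF u(2,3) ad(1) q(3) ad(3) q(2) ad(2)]) (simp_all add: q ad)
        then show "q \<in> {(a, d, S)}" by (simp add: q(1))
      qed
      then show ?thesis by blast
    qed auto
    then obtain p where "?B u \<subseteq> {p}" by blast
    then show "finite (?B u) \<and> card (?B u) \<le> 1"
      using card_mono[of "{p}" "?B u"] finite_subset[of "?B u" "{p}"] by simp
  qed auto
  then show ?thesis by simp
qed

sublocale sparse_family "{..<n}" "ap_index k n" "ap_set n" n k "k * k * 2 ^ k"
proof
  show "3 \<le> card (ap_set n p)" "card (ap_set n p) \<le> k" if "p \<in> ap_index k n" for p
  proof -
    obtain a d S where p: "p = (a, d, S)" by (cases p)
    have S: "S \<subseteq> {0..<k}" "3 \<le> card S" "d \<in> {1..n div 2}" using that unfolding p ap_index_def by auto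
    then show "3 \<le> card (ap_set n p)" "card (ap_set n p) \<le> k"
      using card_ap_set[OF S(3,1), of a] card_mono[OF _ S(1)] unfolding p by auto
  qed
qed (use finite_ap_index ap_set_subset ap_codegree in auto)

lemma ap_family_subset: "l \<ge> 3 \<Longrightarrow> ap_family k n l \<subseteq> ap_index k n"
  unfolding ap_family_def ap_index_def by auto

lemma finite_ap_family: "finite (ap_family k n l)"
proof -
  have "finite {S. S \<subseteq> {0..<k} \<and> card S = l}" by (rule finite_subset[of _ "Pow {0..<k}"]) auto
  then show ?thesis unfolding ap_family_def by auto
qed

lemma card_ap_family: "p \<in> ap_family k n l \<Longrightarrow> card (ap_set n p) = l"
  using card_ap_set by (auto simp: ap_family_def ap_set_def split: if_splits)

section \<open>Identification of the polynomials and their normalising constants\<close>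

lemma sum_mod_shift:
  fixes f :: "nat \<Rightarrow> real"
  shows "(\<Sum>a<n. f ((a + m) mod n)) = (\<Sum>a<n. f a)"
proof -
  have inj: "inj_on (\<lambda>a. (a + m) mod n) {..<n}"
  proof (rule inj_onI)
    fix a b assume ab: "a \<in> {..<n}" "b \<in> {..<n}" "(a + m) mod n = (b + m) mod n"
    have "int n dvd int a - int b" using mod_eq_imp_dvd[OF ab(3)] by simp
    then have "int a mod int n = int b mod int n" by (simp add: mod_eq_dvd_iff)
    then show "a = b" using ab by simp
  qed
  have "(\<lambda>a. (a + m) mod n) ` {..<n} = {..<n}"
    using n1 by (intro endo_inj_surj inj) auto
  then show ?thesis using sum.reindex[OF inj, of f] by simp
qed

lemma kAP_1: "kAP k n 1 y = hpoly (real (k * (n div 2))) (ap_family k n 1) (ap_set n) y"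
proof -
  have S1: "{S. S \<subseteq> {0..<k} \<and> card S = 1} = (\<lambda>i. {i}) ` {0..<k}"
    by (auto simp: card_1_singleton_iff)
  have "kAP k n 1 y = (\<Sum>a<n. \<Sum>d = 1..n div 2. \<Sum>i = 0..<k. y ((a + i * d) mod n))"
    unfolding kAP_def S1 by (simp add: sum.reindex)
  \<comment> \<open>With \<open>a\<close> innermost, each inner sum is a cyclic shift of the sum of
    all variables.\<close>
  also have "\<dots> = (\<Sum>d = 1..n div 2. \<Sum>i = 0..<k. \<Sum>a<n. y ((a + i * d) mod n))"
    by (subst sum.swap, rule sum.cong[OF refl], subst sum.swap, rule refl)
  also have "\<dots> = (\<Sum>d = 1..n div 2. \<Sum>i = 0..<k. \<Sum>a<n. y a)"
    by (simp only: sum_mod_shift)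
  also have "\<dots> = real (k * (n div 2)) * (\<Sum>a<n. y a)" by simp
  also have "(\<Sum>a<n. y a) = (\<Sum>p\<in>ap_family k n 1. \<Prod>v\<in>ap_set n p. y v)"
  proof -
    have eq: "ap_family k n 1 = (\<lambda>a. (a, 1, {0})) ` {..<n}" by (auto simp: ap_family_def)
    show ?thesis unfolding eq by (subst sum.reindex) (auto simp: inj_on_def ap_set_def)
  qed
  finally show ?thesis by (simp add: hpoly_def)
qed

lemma kAP_ge_3:
  assumes "l \<ge> 3"
  shows "kAP k n l y = hpoly 1 (ap_family k n l) (ap_set n) y"
proof -
  have "(\<Sum>p\<in>ap_family k n l. \<Prod>v\<in>ap_set n p. y v)
      = (\<Sum>a<n. \<Sum>d = 1..n div 2. \<Sum>S | S \<subseteq> {0..<k} \<and> card S = l. \<Prod>v\<in>ap_set n (a, d, S). y v)"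
    using assms unfolding ap_family_def by (simp add: sum.cartesian_product case_prod_beta)
  also have "\<dots> = kAP k n l y"
    unfolding kAP_def
  proof (intro sum.cong refl)
    fix a d S assume "d \<in> {1..n div 2}" "S \<in> {S. S \<subseteq> {0..<k} \<and> card S = l}"
    \<comment> \<open>Distinct positions give distinct residues, so no variable repeats and the
      polynomial is multilinear.\<close>
    then have "inj_on (\<lambda>i. (a + i * d) mod n) S" using inj_on_subset[OF ap_inj] by blast
    then show "(\<Prod>v\<in>ap_set n (a, d, S). y v) = (\<Prod>i\<in>S. y ((a + i * d) mod n))"
      by (simp add: ap_set_def prod.reindex)
  qed
  finally show ?thesis by (simp add: hpoly_def)
qed

lemma kAP_sigma_eq:
  assumes "\<And>y. kAP k n l y = hpoly c P A y" "finite P" "\<And>p. p \<in> P \<Longrightarrow> A p \<subseteq> {..<n}" "\<And>p. p \<in> P \<Longrightarrow> A p \<noteq> {}"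
    and N: "N = c\<^sup>2 * real (card {(p, q). p \<in> P \<and> q \<in> P \<and> A p = A q})" "N > 0"
  shows "kAP_sigma k n l = sqrt N"
proof -
  have var: "prob_space.variance (std_gaussian {..<n}) (\<lambda>z. 1 / s * kAP k n l z) = N / s\<^sup>2" for s
    using hpoly_mean[of "{..<n}" P A c] hpoly_second_moment[of "{..<n}" P A c] assms
    by (simp add: power_divide)
  show ?thesis unfolding kAP_sigma_def var
  proof (rule the_equality)
    show "sqrt N > 0 \<and> N / (sqrt N)\<^sup>2 = 1" using N(2) by simp
    fix s assume "s > 0 \<and> N / s\<^sup>2 = 1"
    then have "s\<^sup>2 = N" "s > 0" by (auto simp: field_simps)
    then show "s = sqrt N" using real_sqrt_unique by auto
  qed
qed

lemma ap_set_nonempty: "l \<ge> 1 \<Longrightarrow> p \<in> ap_family k n l \<Longrightarrow> ap_set n p \<noteq> {}"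
  using card_ap_family by fastforce

text \<open>The second moment of the unnormalised sum over \<open>ap_family k n l\<close>, as
  squarefree monomials are orthonormal.\<close>

definition "coincidences l = real (card {(p, q). p \<in> ap_family k n l \<and> q \<in> ap_family k n l \<and> ap_set n p = ap_set n q})"

lemma coincidences_1: "coincidences 1 = real n"
proof -
  have "{(p, q). p \<in> ap_family k n 1 \<and> q \<in> ap_family k n 1 \<and> ap_set n p = ap_set n q}
      = (\<lambda>a. ((a, 1, {0}), (a, 1, {0}))) ` {..<n}"
    by (auto simp: ap_family_def ap_set_def)
  also have "card \<dots> = n" by (subst card_image) (auto simp: inj_on_def)
  finally show ?thesis by (simp add: coincidences_def)
qed

text \<open>The diagonal pairs \<open>(p, p)\<close> alone suffice; the factor 3 comes from
  \<open>half_ge\<close>.\<close>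

lemma coincidences_ge:
  assumes l: "3 \<le> l" "l \<le> k"
  shows "3 * coincidences l \<ge> real n ^ 2"
proof -
  let ?F = "ap_family k n l"
  let ?R = "{(p, q). p \<in> ?F \<and> q \<in> ?F \<and> ap_set n p = ap_set n q}"
  have "card ?F = n * ((n div 2) * (k choose l))"
    using l n_subsets[of "{0..<k}" l] by (simp add: ap_family_def card_cartesian_product)
  moreover have "1 \<le> k choose l" using zero_less_binomial[OF l(2)] by linarith
  ultimately have "n * (n div 2) \<le> card ?F" by simp
  also have "card ?F = card ((\<lambda>p. (p, p)) ` ?F)" by (rule card_image[symmetric]) (auto simp: inj_on_def)
  also have "\<dots> \<le> card ?R"
    by (rule card_mono) (auto intro: finite_subset[of _ "?F \<times> ?F"] simp: finite_ap_family)
  finally have "n * (n div 2) \<le> card ?R" .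
  moreover have "n * n \<le> n * (3 * (n div 2))" by (rule mult_le_mono2[OF half_ge])
  ultimately have "n * n \<le> 3 * card ?R" by linarith
  then have "real (n * n) \<le> real (3 * card ?R)" by (rule of_nat_mono)
  then show ?thesis by (simp add: coincidences_def power2_eq_square)
qed

lemma sigma_1: "kAP_sigma k n 1 = real (k * (n div 2)) * sqrt (real n)"
proof -
  have "kAP_sigma k n 1 = sqrt ((real (k * (n div 2)))\<^sup>2 * coincidences 1)"
    unfolding coincidences_def using coincidences_1[unfolded coincidences_def] n1 half_pos k
    by (intro kAP_sigma_eq[OF kAP_1 finite_ap_family ap_set_subset ap_set_nonempty[of 1] refl]) auto
  then show ?thesis by (simp add: coincidences_1 real_sqrt_mult del: One_nat_def)
qed

lemma coincidences_pos: "3 \<le> l \<Longrightarrow> l \<le> k \<Longrightarrow> coincidences l > 0"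
  using coincidences_ge[of l] n1 by (smt (verit) of_nat_0_less_iff zero_less_power zero_less_one order_less_trans)

lemma sigma_ge_3:
  assumes l: "3 \<le> l" "l \<le> k"
  shows "kAP_sigma k n l = sqrt (coincidences l)"
  using coincidences_pos[OF l] l
  by (intro kAP_sigma_eq[OF kAP_ge_3[OF l(1)] finite_ap_family ap_set_subset ap_set_nonempty]) (auto simp: coincidences_def)

lemma kAP_bar_eq:
  assumes l: "l \<in> {1..k} - {2}"
  shows "kAP_bar k n l y = hpoly (ap_coeff k n l) (ap_family k n l) (ap_set n) y"
proof (cases "l = 1")
  case True
  have "k \<noteq> 0" "n div 2 \<noteq> 0" using half_pos k by auto
  then show ?thesis unfolding True kAP_bar_def kAP_1 sigma_1 by (simp add: ap_coeff_def hpoly_def del: One_nat_def)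
next
  case False
  then have "l \<ge> 3" using l by auto
  then show ?thesis by (simp add: kAP_bar_def kAP_ge_3 ap_coeff_def hpoly_def)
qed

lemma ap_coeff_sq_coincidences:
  assumes l: "l \<in> {1..k} - {2}"
  shows "(ap_coeff k n l)\<^sup>2 * coincidences l = 1"
proof (cases "l = 1")
  case True
  then show ?thesis using n1 coincidences_1 by (simp add: ap_coeff_def power_divide)
next
  case False
  then have "l \<ge> 3" "l \<le> k" using l by auto
  then show ?thesis using coincidences_pos[of l] by (simp add: ap_coeff_def sigma_ge_3 power_divide)
qed

lemma ap_coeff_sq_le:
  assumes l: "3 \<le> l" "l \<le> k"
  shows "(ap_coeff k n l)\<^sup>2 \<le> 3 / real n ^ 2"
proof -
  have "l \<in> {1..k} - {2}" using l by auto
  then have "(ap_coeff k n l)\<^sup>2 = 1 / coincidences l" using ap_coeff_sq_coincidences[of l] coincidences_pos[OF l] by (simp add: field_simps)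
  also have "\<dots> \<le> 3 / real n ^ 2"
    using coincidences_pos[OF l] coincidences_ge[OF l] n1 by (simp add: field_simps)
  finally show ?thesis .
qed

text \<open>The 9 is the product of two constants 3 from \<open>ap_coeff_sq_le\<close> when both
  degrees are at least 3; the second summand, with a single such constant, covers a pair of degrees
  one of which is 1.\<close>

definition "err_const = 9 * (3 ^ (4 * k) * real rel_const)
  + 3 * (3 ^ (2 * k) * real (k * k * 2 ^ k * k * (k * k * (k * k * 2 ^ k) * k)))"

lemma err_const_nonneg: "0 \<le> err_const"
  unfolding err_const_def by simp

abbreviation "ap_poly l \<equiv> hpoly (ap_coeff k n l) (ap_family k n l) (ap_set n)"
abbreviation "ap_grad l \<equiv> hgrad (ap_coeff k n l) (ap_family k n l) (ap_set n)"

lemma ap_grad_1: "a < n \<Longrightarrow> ap_grad 1 a x = 1 / sqrt (real n)"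
proof -
  assume a: "a < n"
  have "{p \<in> ap_family k n 1. a \<in> ap_set n p} = {(a, 1, {0})}"
    using a by (auto simp: ap_family_def ap_set_def)
  then show ?thesis by (simp add: hgrad_def ap_coeff_def ap_set_def a)
qed

text \<open>Two degrees 1: constant gradients, no error. One degree 1: n^-1 n^-2 from the
  coefficients times n^2 related flags. No degree 1: n^-4 times n^3 related triples.\<close>

lemma gradient_error_le:
  assumes I: "finite I" "{..<n} \<subseteq> I" and l: "l \<in> {1..k} - {2}" and m: "m \<in> {1..k} - {2}"
  shows "(\<integral>x. ((\<Sum>a<n. ap_grad l a x * ap_grad m a x) / real l - of_bool (l = m))\<^sup>2 \<partial>std_gaussian I)
    \<le> err_const / real n"
proof -
  have n: "real n > 0" using n1 by simp
  \<comment> \<open>\<open>b\<close> is the constant gradient component of degree 1, divided by the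
    degree that indexes the row.\<close>
  have mixed: "(\<integral>x. (b * (\<Sum>a<n. ap_grad m a x))\<^sup>2 \<partial>std_gaussian I) \<le> err_const / real n"
    if m: "3 \<le> m" "m \<le> k" and b: "b\<^sup>2 \<le> 1 / real n" for b m
  proof -
    let ?c = "3 ^ (2 * k) * real (k * k * 2 ^ k * k * (k * k * (k * k * 2 ^ k) * k))"
    have "(\<integral>x. (b * (\<Sum>a<n. ap_grad m a x))\<^sup>2 \<partial>std_gaussian I)
        \<le> (b * ap_coeff k n m)\<^sup>2 * (?c * real n ^ 2)"
      by (rule second_moment_gradient_sum_le[OF I ap_family_subset[OF m(1)]])
    also have "\<dots> \<le> (1 / real n * (3 / real n ^ 2)) * (?c * real n ^ 2)"
      unfolding power_mult_distrib by (intro mult_right_mono mult_mono b ap_coeff_sq_le m) auto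
    also have "\<dots> = 3 * ?c / real n" using n by (simp add: field_simps)
    also have "\<dots> \<le> err_const / real n"
      using n by (intro divide_right_mono) (auto simp: err_const_def)
    finally show ?thesis .
  qed
  consider "l = 1" "m = 1" | "l = 1" "3 \<le> m" | "3 \<le> l" "m = 1" | "3 \<le> l" "3 \<le> m"
    using l m by fastforce
  then show ?thesis
  proof cases
    case 1
    then show ?thesis using n err_const_nonneg by (simp add: ap_grad_1 del: One_nat_def)
  next
    case 2
    have "(\<Sum>a<n. ap_grad l a x * ap_grad m a x) / real l - of_bool (l = m)
        = 1 / sqrt (real n) * (\<Sum>a<n. ap_grad m a x)" for x
      using 2 by (simp add: ap_grad_1 sum_distrib_left del: One_nat_def)
    then show ?thesis using mixed[of m "1 / sqrt (real n)"] 2 m n by (simp add: power_divide)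
  next
    case 3
    have "(\<Sum>a<n. ap_grad l a x * ap_grad m a x) / real l - of_bool (l = m)
        = 1 / sqrt (real n) / real l * (\<Sum>a<n. ap_grad l a x)" for x
      using 3 by (simp add: ap_grad_1 sum_divide_distrib sum_distrib_left del: One_nat_def)
    moreover have "(1 / sqrt (real n) / real l)\<^sup>2 \<le> 1 / real n"
    proof -
      have "(1 / sqrt (real n) / real l)\<^sup>2 = 1 / real n / (real l)\<^sup>2" using n by (simp add: power_divide power_mult_distrib)
      also have "\<dots> \<le> 1 / real n / 1" using 3 n by (intro divide_left_mono) (auto intro!: one_le_power)
      finally show ?thesis by simp
    qed
    ultimately show ?thesis using mixed[of l "1 / sqrt (real n) / real l"] 3 l by simp
  next
    case 4
    let ?c = "3 ^ (4 * k) * real rel_const"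
    note sub = ap_family_subset[OF 4(1)] ap_family_subset[OF 4(2)]
    have lk: "l \<le> k" "m \<le> k" "real l \<ge> 1" using l m by auto
    \<comment> \<open>Progressions of different sizes never coincide. For equal degrees the factor
      \<open>real l\<close> cancels, leaving the squared coefficient times
      \<open>coincidences l\<close>, which is 1 by normalisation.\<close>
    have \<delta>: "of_bool (l = m) = ap_coeff k n l * ap_coeff k n m / real l *
        (\<Sum>t\<in>triples_between (ap_family k n l) (ap_family k n m). monomial_mean {..<n} (covering t))"
    proof (cases "l = m")
      case True
      have "(\<Sum>t\<in>triples_between (ap_family k n l) (ap_family k n l). monomial_mean {..<n} (covering t)) = real l * coincidences l"
        unfolding coincidences_def by (rule sum_monomial_mean_same[OF sub(1) card_ap_family])
      then show ?thesis using True ap_coeff_sq_coincidences[OF l] lk by (simp add: power2_eq_square)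
    next
      case False
      have "(\<Sum>t\<in>triples_between (ap_family k n l) (ap_family k n m). monomial_mean {..<n} (covering t)) = 0"
        by (rule sum_monomial_mean_distinct[OF sub]) (use card_ap_family False in metis)
      then show ?thesis using False by simp
    qed
    have "(\<integral>x. ((\<Sum>a<n. ap_grad l a x * ap_grad m a x) / real l - of_bool (l = m))\<^sup>2 \<partial>std_gaussian I)
      \<le> (ap_coeff k n l * ap_coeff k n m / real l)\<^sup>2 * (?c * real n ^ 3)"
      by (rule variance_gradient_product_le[OF I sub \<delta>])
    also have "\<dots> \<le> (3 / real n ^ 2 * (3 / real n ^ 2)) * (?c * real n ^ 3)"
    proof (intro mult_right_mono)
      have "(ap_coeff k n l * ap_coeff k n m / real l)\<^sup>2 = (ap_coeff k n l)\<^sup>2 * (ap_coeff k n m)\<^sup>2 / (real l)\<^sup>2"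
        by (simp add: power_divide power_mult_distrib)
      also have "\<dots> \<le> (ap_coeff k n l)\<^sup>2 * (ap_coeff k n m)\<^sup>2 / 1"
        using lk by (intro divide_left_mono) (auto intro!: one_le_power)
      also have "\<dots> \<le> 3 / real n ^ 2 * (3 / real n ^ 2)"
        unfolding div_by_1 using 4 lk by (intro mult_mono ap_coeff_sq_le) auto
      finally show "(ap_coeff k n l * ap_coeff k n m / real l)\<^sup>2 \<le> 3 / real n ^ 2 * (3 / real n ^ 2)" .
    qed simp
    also have "\<dots> = 9 * ?c / real n" using n by (simp add: field_simps power2_eq_square power3_eq_cube)
    also have "\<dots> \<le> err_const / real n"
      using n by (intro divide_right_mono) (auto simp: err_const_def)
    finally show ?thesis .
  qed
qed

end


text \<open>\<open>idx\<close> lists the degrees in an arbitrary order, so the components of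
  \<open>W\<close> may be indexed by any finite type of the right size.\<close>

theorem theorem6p1:
  fixes k :: nat
  assumes "k \<ge> 3" and "CARD('m::finite) = k - 1"
  shows "\<exists>C::real. \<forall>n::nat. n > 1 \<longrightarrow> gcd n (fact (k - 1)) = 1 \<longrightarrow>
    (\<forall>(idx :: 'm \<Rightarrow> nat) (g :: real^'m \<Rightarrow> real).
       bij_betw idx UNIV ({1..k} - {2}) \<longrightarrow> C_class 3 g \<longrightarrow>
       M_sup 2 g < \<infinity> \<longrightarrow> M_sup 3 g < \<infinity> \<longrightarrow>
       ereal \<bar>(\<integral>y. g (\<chi> j. kAP_bar k n (idx j) y) \<partial>std_gaussian {..<n})
              - (\<integral>z. g (\<chi> j. z j) \<partial>std_gaussian UNIV)\<bar>
         \<le> ereal C * (M_sup 2 g + M_sup 3 g) / ereal (real n powr (1 / 2)))"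
proof (intro exI allI impI)
  fix n :: nat and idx :: "'m \<Rightarrow> nat" and g :: "real^'m \<Rightarrow> real"
  \<comment> \<open>Outside its locale, \<open>err_const\<close> depends on \<open>k\<close> alone,
    so the constant is chosen before \<open>n\<close>.\<close>
  let ?B = "ap_modulus.err_const k" and ?N = "real CARD('m)"
  assume n: "n > 1" "gcd n (fact (k - 1)) = 1" and idx: "bij_betw idx UNIV ({1..k} - {2})"
    and g: "C_class 3 g" and fin: "M_sup 2 g < \<infinity>" "M_sup 3 g < \<infinity>"
  interpret ap: ap_modulus k n using assms(1) n by unfold_locales
  obtain M2 M3 where M: "M_sup 2 g = ereal M2" "M_sup 3 g = ereal M3" "0 \<le> M3"
    using fin M_sup_nonneg[of 2 g] M_sup_nonneg[of 3 g] by (cases "M_sup 2 g"; cases "M_sup 3 g") auto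
  have idx_in: "idx j \<in> {1..k} - {2}" for j using bij_betwE[OF idx] by blast
  have idx_inj: "inj idx" using idx by (simp add: bij_betw_def)
  \<comment> \<open>The first \<open>n\<close> coordinates carry \<open>y\<close>; the coordinates
    \<open>n + idx j\<close>, at most \<open>n + k\<close>, carry \<open>Z\<close>.\<close>
  define I where "I = {..<n + k + 1}"
  define \<zeta> where "\<zeta> j = n + idx j" for j
  have I: "finite I" "{..<n} \<subseteq> I" by (auto simp: I_def)
  have \<zeta>: "\<zeta> j \<in> I" for j using idx_in[of j] by (simp add: I_def \<zeta>_def)
  have sub: "ap_set n p \<subseteq> I" for p using ap.ap_set_subset I(2) by blast
  interpret gi: gaussian_interpolation I "{..<n}" \<zeta> "\<lambda>j. ap.ap_poly (idx j)" "\<lambda>j. ap.ap_grad (idx j)"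
    "\<lambda>j. real (idx j)" g "\<lambda>i. partials [i] g" "\<lambda>j i. partials [j, i] g" M2
  proof
    show "inj \<zeta>" using idx_inj by (simp add: \<zeta>_def inj_def)
    have fA: "finite (ap_set n p)" for p using sub I(1) finite_subset by blast
    show "ap.ap_poly (idx j) (x(a := t)) = ap.ap_poly (idx j) x + (t - x a) * ap.ap_grad (idx j) a x" for j x a t
      by (rule hpoly_upd[OF ap.finite_ap_family fA])
    show "ap.ap_poly (idx j) (x(a := t)) = ap.ap_poly (idx j) x" if "a \<notin> {..<n}" for j x a t
      using that ap.ap_set_subset by (intro hpoly_cong) auto
    show "(\<Sum>a<n. x a * ap.ap_grad (idx j) a x) = real (idx j) * ap.ap_poly (idx j) x" for j x
      by (rule hpoly_euler[OF ap.finite_ap_family finite_lessThan ap.ap_set_subset ap.card_ap_family])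
    show "real (idx j) > 0" for j using idx_in[of j] by simp
    show "(g has_derivative (\<lambda>v. \<Sum>i\<in>UNIV. v $ i * partials [i] g u)) (at u)" for u
      using C_class_partials(3)[OF g, of "[]" u] by (simp add: partials_simps(1))
    show "(partials [i] g has_derivative (\<lambda>v. \<Sum>j\<in>UNIV. v $ j * partials [j, i] g u)) (at u)" for i u
      using C_class_partials(3)[OF g, of "[i]" u] by simp
    show "continuous_on UNIV (partials [j, i] g)" for j i
      using C_class_partials(1)[OF g, of "[j, i]"] by simp
    show "\<bar>partials [j, i] g u\<bar> \<le> M2" for j i u
      using abs_partials_le_M_sup[of "[j, i]" g u] M(1) by (simp add: numeral_2_eq_2)
    show "all_moments (std_gaussian I) (ap.ap_poly (idx j))" for j
      by (rule all_moments_hpoly[OF sub])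
    show "all_moments (std_gaussian I) (ap.ap_grad (idx j) a)" for j a
      by (rule all_moments_hgrad[OF sub])
  qed (use I \<zeta> in \<open>auto simp: \<zeta>_def hgrad_upd\<close>)
  have X: "(\<integral>x. \<bar>gi.discrepancy i j x\<bar> \<partial>std_gaussian I) \<le> (?B + 1) / (2 * sqrt (real n))" for i j
  proof -
    interpret prob_space "std_gaussian I" by (rule prob_space_std_gaussian)
    \<comment> \<open>\<open>idx\<close> is injective, so equality of components and equality of
      degrees give the same Kronecker symbol.\<close>
    have second: "(\<integral>x. (gi.discrepancy i j x)\<^sup>2 \<partial>std_gaussian I) \<le> ?B / real n"
      using ap.gradient_error_le[OF I idx_in[of i] idx_in[of j]] inj_eq[OF idx_inj, of i j]
      by (simp add: gi.discrepancy_def[abs_def] of_bool_def)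
    have "(\<integral>x. \<bar>gi.discrepancy i j x\<bar> \<partial>std_gaussian I)
        \<le> (sqrt (real n) * (\<integral>x. (gi.discrepancy i j x)\<^sup>2 \<partial>std_gaussian I) + 1 / sqrt (real n)) / 2"
      using n(1) by (intro expectation_abs_le gi.discrepancy_moments) simp
    also have "\<dots> \<le> (sqrt (real n) * (?B / real n) + 1 / sqrt (real n)) / 2"
      using second by (intro divide_right_mono add_right_mono mult_left_mono) auto
    also have "\<dots> = (?B + 1) / (2 * sqrt (real n))"
      using n(1) by (simp add: field_simps flip: power2_eq_square)
    finally show ?thesis .
  qed
  have W_meas: "(\<lambda>y. g (\<chi> j. kAP_bar k n (idx j) y)) \<in> borel_measurable (std_gaussian {..<n})"
  proof -
    have "(\<lambda>y. \<chi> j. kAP_bar k n (idx j) y) \<in> borel_measurable (std_gaussian {..<n})"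
      unfolding ap.kAP_bar_eq[OF idx_in]
      by (intro borel_measurable_vec_lambda all_moments_measurable all_moments_hpoly ap.ap_set_subset)
    then show ?thesis by (rule measurable_compose[OF _ borel_measurable_continuous_onI[OF gi.g_cont]])
  qed
  have Z_meas: "(\<lambda>z. g (\<chi> j. z j)) \<in> borel_measurable (std_gaussian UNIV)"
    by (rule measurable_compose[OF _ borel_measurable_continuous_onI[OF gi.g_cont]])
      (intro borel_measurable_vec_lambda measurable_coord UNIV_I)
  have "(\<integral>y. g (\<chi> j. kAP_bar k n (idx j) y) \<partial>std_gaussian {..<n})
      = (\<integral>x. g (\<chi> j. kAP_bar k n (idx j) (\<lambda>i\<in>{..<n}. x i)) \<partial>std_gaussian I)"
    using integral_std_gaussian_reindex[of "\<lambda>i. i" "{..<n}" I, OF _ _ W_meas] I(2) by auto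
  also have "\<dots> = (\<integral>x. g (\<chi> j. ap.ap_poly (idx j) x) \<partial>std_gaussian I)"
  proof -
    have "kAP_bar k n (idx j) (\<lambda>i\<in>{..<n}. x i) = ap.ap_poly (idx j) x" for j x
      unfolding ap.kAP_bar_eq[OF idx_in] using ap.ap_set_subset by (intro hpoly_cong) auto
    then show ?thesis by simp
  qed
  finally have W: "(\<integral>y. g (\<chi> j. kAP_bar k n (idx j) y) \<partial>std_gaussian {..<n})
      = (\<integral>x. g (\<chi> j. ap.ap_poly (idx j) x) \<partial>std_gaussian I)" .
  have Z: "(\<integral>z. g (\<chi> j. z j) \<partial>std_gaussian UNIV) = (\<integral>x. g (\<chi> j. x (\<zeta> j)) \<partial>std_gaussian I)"
    using integral_std_gaussian_reindex[OF gi.inj_\<zeta> _ Z_meas, of I] \<zeta> by simp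
  have "\<bar>(\<integral>y. g (\<chi> j. kAP_bar k n (idx j) y) \<partial>std_gaussian {..<n}) - (\<integral>z. g (\<chi> j. z j) \<partial>std_gaussian UNIV)\<bar>
      \<le> 2 * M2 * (\<Sum>i\<in>UNIV. \<Sum>j\<in>UNIV. \<integral>x. \<bar>gi.discrepancy i j x\<bar> \<partial>std_gaussian I)"
    unfolding W Z by (rule gi.interpolation_bound)
  also have "\<dots> \<le> 2 * M2 * (\<Sum>i\<in>(UNIV::'m set). \<Sum>j\<in>(UNIV::'m set). (?B + 1) / (2 * sqrt (real n)))"
    using gi.M_nonneg by (intro mult_left_mono sum_mono X) auto
  also have "\<dots> = ?N\<^sup>2 * (?B + 1) * M2 / sqrt (real n)"
    by (simp add: power2_eq_square)
  also have "\<dots> \<le> ?N\<^sup>2 * (?B + 1) * (M2 + M3) / sqrt (real n)"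
    using M(3) ap.err_const_nonneg by (intro divide_right_mono mult_left_mono) auto
  finally show "ereal \<bar>(\<integral>y. g (\<chi> j. kAP_bar k n (idx j) y) \<partial>std_gaussian {..<n})
              - (\<integral>z. g (\<chi> j. z j) \<partial>std_gaussian UNIV)\<bar>
         \<le> ereal (?N\<^sup>2 * (?B + 1)) * (M_sup 2 g + M_sup 3 g) / ereal (real n powr (1 / 2))"
    using n(1) by (simp add: M(1,2) powr_half_sqrt)
qed

end
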